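(* Let $N\ge1$, $u:\mathbb{R}^N\to\mathbb{R}$, $h>0$ and $x\in\mathbb{R}^N$. Consider the minimization problem $$\min_{G_{u,h}\in\mathbb{R}^N,\;H_{u,h}\in\mathrm{Sym}(\mathbb{R}^{N\times N})}\ \frac12\int_{h\mathcal{S}^{N-1}}\Big(u(x+z)-u(x)-G_{u,h}^{\top}z-\tfrac12z^{\top}H_{u,h}z\Big)^2\,d\mathcal{H}^{N-1}(z),$$ and assume that the integral is finite for every $G_{u,h}\in\mathbb{R}^N$ and $H_{u,h}\in\mathbb{R}^{N\times N}$. Then the Hessian part $H'_{u,h}$ of the minimizing pair $(G'_{u,h},H'_{u,h})$ is given by $$H'_{u,h}=\frac12\,C_{12}^{-1}\,h^{-(N-1)}\int_{h\mathcal{S}^{N-1}}\left(\frac{u(x+z)-2u(x)+u(x-z)}{|z|^2}\right)\left(\frac{zz^{\top}}{|z|^2}-\frac{1}{N+2}I\right)d\mathcal{H}^{N-1}(z).$$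
   Context: $\mathcal{S}^{N-1}$ is the unit sphere in $\mathbb{R}^N$, $h\mathcal{S}^{N-1}$ the sphere of radius $h$ centred at $0$, $\mathcal{H}^{N-1}$ the $(N-1)$-dimensional Hausdorff measure, $\mathrm{Sym}(\mathbb{R}^{N\times N})$ the symmetric $N\times N$ real matrices, and $I$ the $N\times N$ identity matrix. The constant $C_{12}$ is $C_{12}=\int_{\mathcal{S}^{N-1}}\nu_1^2\nu_2^2\,d\mathcal{H}^{N-1}(\nu)=\frac{|\mathcal{S}^{N-1}|}{N(N+2)}$, where $|\mathcal{S}^{N-1}|=\mathcal{H}^{N-1}(\mathcal{S}^{N-1})$; for $N=1$ it denotes the value $\frac{|\mathcal{S}^{0}|}{3}=\frac23$. *)

theory Defs
  imports "HOL-Analysis.Analysis"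
begin

section \<open>Hausdorff measure\<close>

text \<open>
  The factor \<^term>\<open>unit_ball_vol (real d)\<close> is the usual normalisation, under which the
  \<open>d\<close>-dimensional Hausdorff measure agrees with the \<open>d\<close>-dimensional Lebesgue measure on
  \<open>d\<close>-dimensional Euclidean space.  For \<open>d = 0\<close> a nonempty set has gauge \<open>1\<close> (as \<open>0 ^ 0 = 1\<close>), so that
  the \<open>0\<close>-dimensional Hausdorff measure is the counting measure.
\<close>
definition hausdorff_gauge :: "nat \<Rightarrow> 'a::metric_space set \<Rightarrow> ennreal" where
  "hausdorff_gauge d A =
     (if A = {} then 0 else ennreal (unit_ball_vol (real d) * (diameter A / 2) ^ d))"

text \<open>Boundedness is required because \<^const>\<open>diameter\<close> is unspecified on unbounded sets.\<close>
definition fine_covers :: "real \<Rightarrow> 'a::metric_space set \<Rightarrow> (nat \<Rightarrow> 'a set) set" where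
  "fine_covers \<delta> A = {C. A \<subseteq> (\<Union>i. C i) \<and> (\<forall>i. bounded (C i) \<and> diameter (C i) \<le> \<delta>)}"

definition hausdorff_premeasure :: "nat \<Rightarrow> real \<Rightarrow> 'a::metric_space set \<Rightarrow> ennreal" where
  "hausdorff_premeasure d \<delta> A = (INF C\<in>fine_covers \<delta> A. \<Sum>i. hausdorff_gauge d (C i))"

definition hausdorff_outer :: "nat \<Rightarrow> 'a::metric_space set \<Rightarrow> ennreal" where
  "hausdorff_outer d A = (SUP \<delta>\<in>{0<..}. hausdorff_premeasure d \<delta> A)"

text \<open>The measurable sets are all the Caratheodory measurable ones, not only the Borel sets.\<close>
definition hausdorff_measure :: "nat \<Rightarrow> 'a::metric_space measure" where
  "hausdorff_measure d =
     measure_of UNIV (lambda_system UNIV UNIV (hausdorff_outer d)) (hausdorff_outer d)"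

lemma hausdorff_premeasure_empty:
  assumes "\<delta> > 0"
  shows "hausdorff_premeasure d \<delta> ({} :: 'a::metric_space set) = 0"
proof -
  have "(\<lambda>_. {}) \<in> fine_covers \<delta> ({} :: 'a set)"
    using assms by (auto simp: fine_covers_def)
  then have "hausdorff_premeasure d \<delta> ({} :: 'a set) \<le> (\<Sum>i::nat. hausdorff_gauge d ({} :: 'a set))"
    unfolding hausdorff_premeasure_def by (rule INF_lower2) simp
  then show ?thesis by (simp add: hausdorff_gauge_def)
qed

lemma hausdorff_premeasure_mono:
  "A \<subseteq> B \<Longrightarrow> hausdorff_premeasure d \<delta> A \<le> hausdorff_premeasure d \<delta> B"
  unfolding hausdorff_premeasure_def
  by (rule INF_superset_mono) (auto simp: fine_covers_def)

lemma hausdorff_premeasure_subadditive: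
  fixes A :: "nat \<Rightarrow> 'a::metric_space set"
  shows "hausdorff_premeasure d \<delta> (\<Union>n. A n) \<le> (\<Sum>n. hausdorff_premeasure d \<delta> (A n))"
proof (rule ennreal_le_epsilon)
  let ?P = "hausdorff_premeasure d \<delta>" and ?g = "hausdorff_gauge d :: 'a set \<Rightarrow> ennreal"
  fix e :: real assume "0 < e" "(\<Sum>n. ?P (A n)) < top"
  then have *: "?P (A n) < ?P (A n) + e * (1/2)^Suc n" for n
    by (auto simp add: less_top dest!: ennreal_suminf_lessD)
  have "\<exists>C. C \<in> fine_covers \<delta> (A n) \<and> (\<Sum>i. ?g (C i)) < ?P (A n) + e * (1/2)^Suc n" for n
    using *[of n] unfolding hausdorff_premeasure_def[of d \<delta> "A n"] INF_less_iff by blast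
  then obtain B where B: "\<And>n. B n \<in> fine_covers \<delta> (A n)"
    and Ble: "\<And>n. (\<Sum>i. ?g (B n i)) < ?P (A n) + e * (1/2)^Suc n"
    by metis
  define C where "C = case_prod B \<circ> prod_decode"
  have cov: "C \<in> fine_covers \<delta> (\<Union>n. A n)"
  proof -
    have "x \<in> (\<Union>i. C i)" if "x \<in> A n" for x n
    proof -
      have "A n \<subseteq> (\<Union>i. B n i)" using B[of n] by (simp add: fine_covers_def)
      with that obtain i where "x \<in> B n i" by blast
      then have "x \<in> C (prod_encode (n, i))" by (simp add: C_def)
      then show ?thesis by blast
    qed
    then show ?thesis using B by (auto simp: fine_covers_def C_def split_def)
  qed
  have "?P (\<Union>n. A n) \<le> (\<Sum>i. ?g (C i))"
    unfolding hausdorff_premeasure_def by (rule INF_lower[OF cov])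
  also have "\<dots> = (\<Sum>n. \<Sum>i. ?g (B n i))"
    unfolding C_def
    using suminf_ennreal_2dimen[of "\<lambda>n. \<Sum>i. ?g (B n i)" "\<lambda>(n, i). ?g (B n i)"]
    by (simp add: comp_def split_def)
  also have "\<dots> \<le> (\<Sum>n. ?P (A n) + e * (1/2) ^ Suc n)"
    using Ble by (intro suminf_le) (auto intro: less_imp_le)
  also have "\<dots> = (\<Sum>n. ?P (A n)) + (\<Sum>n. ennreal e * ennreal ((1/2) ^ Suc n))"
    using \<open>0 < e\<close> by (subst suminf_add[symmetric])
                     (auto simp del: ennreal_suminf_cmult simp add: ennreal_mult[symmetric])
  also have "\<dots> = (\<Sum>n. ?P (A n)) + e"
    unfolding ennreal_suminf_cmult
    by (subst suminf_ennreal_eq[OF zero_le_power power_half_series]) auto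
  finally show "?P (\<Union>n. A n) \<le> (\<Sum>n. ?P (A n)) + e" .
qed

lemma outer_measure_space_hausdorff_outer:
  "outer_measure_space UNIV (hausdorff_outer d :: 'a::metric_space set \<Rightarrow> ennreal)"
proof -
  have "hausdorff_outer d (\<Union>n. A n) \<le> (\<Sum>n. hausdorff_outer d (A n))"
    for A :: "nat \<Rightarrow> 'a set"
    unfolding hausdorff_outer_def[of d "\<Union>n. A n"]
  proof (rule SUP_least)
    fix \<delta> :: real assume "\<delta> \<in> {0<..}"
    then have "(\<Sum>n. hausdorff_premeasure d \<delta> (A n)) \<le> (\<Sum>n. hausdorff_outer d (A n))"
      by (intro suminf_le) (auto simp: hausdorff_outer_def intro: SUP_upper)
    then show "hausdorff_premeasure d \<delta> (\<Union>n. A n) \<le> (\<Sum>n. hausdorff_outer d (A n))"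
      using hausdorff_premeasure_subadditive order_trans by blast
  qed
  moreover have "hausdorff_outer d ({} :: 'a set) = 0"
    by (auto simp: hausdorff_outer_def hausdorff_premeasure_empty)
  moreover have "hausdorff_outer d A \<le> hausdorff_outer d B" if "A \<subseteq> B" for A B :: "'a set"
    unfolding hausdorff_outer_def
    by (rule SUP_mono) (use hausdorff_premeasure_mono[OF that] in blast)
  ultimately show ?thesis
    by (auto simp: outer_measure_space_def positive_def increasing_def countably_subadditive_def)
qed

lemma measure_space_hausdorff:
  "measure_space UNIV (lambda_system UNIV UNIV (hausdorff_outer d))
     (hausdorff_outer d :: 'a::metric_space set \<Rightarrow> ennreal)"
proof -
  have "sigma_algebra UNIV (UNIV :: 'a set set)"
    using sigma_algebra_Pow[of "UNIV :: 'a set"] by simp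
  then show ?thesis
    using outer_measure_space_hausdorff_outer by (rule sigma_algebra.caratheodory_lemma)
qed

lemma space_hausdorff_measure [simp]: "space (hausdorff_measure d) = UNIV"
  by (simp add: hausdorff_measure_def space_measure_of_conv)

lemma sets_hausdorff_measure:
  "sets (hausdorff_measure d :: 'a::metric_space measure) =
     lambda_system UNIV UNIV (hausdorff_outer d)"
  using measure_space_hausdorff[of d, where 'a = 'a] unfolding hausdorff_measure_def
  by (intro sigma_algebra.sets_measure_of_eq) (simp add: measure_space_def)

lemma emeasure_hausdorff_measure:
  fixes A :: "'a::metric_space set"
  shows "A \<in> sets (hausdorff_measure d) \<Longrightarrow>
    emeasure (hausdorff_measure d) A = hausdorff_outer d A"
  using measure_space_hausdorff[of d, where 'a = 'a] unfolding sets_hausdorff_measure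
  unfolding hausdorff_measure_def
  by (simp add: measure_space_def emeasure_measure_of_sigma)

section \<open>The least-squares problem on the sphere\<close>

text \<open>The measure \<open>\<H>\<close> of codimension one on \<open>\<real>\<^sup>N\<close>, where \<open>N = CARD('n) \<ge> 1\<close>.\<close>
abbreviation surface_measure :: "(real ^ 'n) measure" where
  "surface_measure \<equiv> hausdorff_measure (CARD('n) - 1)"

definition outer_prod :: "real ^ 'n \<Rightarrow> real ^ 'n \<Rightarrow> real ^ 'n ^ 'n" where
  "outer_prod v w = (\<chi> i j. v $ i * w $ j)"

text \<open>
  The indices \<open>a\<close> and \<open>b\<close> stand for the coordinates \<open>1\<close> and \<open>2\<close>; they are meant to be distinct
  if \<open>N \<ge> 2\<close>, and are irrelevant if \<open>N = 1\<close>, where the integral is replaced by the convention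
  \<open>\<bar>S\<^sup>0\<bar> / 3\<close>.
\<close>
definition C12 :: "'n \<Rightarrow> 'n::finite \<Rightarrow> real" where
  "C12 a b =
     (if CARD('n) = 1 then measure surface_measure (sphere (0 :: real ^ 'n) 1) / 3
      else (LINT \<nu>:sphere (0 :: real ^ 'n) 1|surface_measure. (\<nu> $ a)\<^sup>2 * (\<nu> $ b)\<^sup>2))"

definition sq_residual ::
    "(real ^ 'n \<Rightarrow> real) \<Rightarrow> real ^ 'n \<Rightarrow> real ^ 'n \<Rightarrow> real ^ 'n ^ 'n \<Rightarrow> real ^ 'n \<Rightarrow> real" where
  "sq_residual u x G H z = (u (x + z) - u x - G \<bullet> z - 1 / 2 * (z \<bullet> (H *v z)))\<^sup>2"

definition energy ::
    "(real ^ 'n \<Rightarrow> real) \<Rightarrow> real \<Rightarrow> real ^ 'n \<Rightarrow> (real ^ 'n) \<times> (real ^ 'n ^ 'n) \<Rightarrow> real" where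
  "energy u h x = (\<lambda>(G, H). 1 / 2 * (LINT z:sphere 0 h|surface_measure. sq_residual u x G H z))"

text \<open>Minimising pairs among all \<open>G\<close> and all symmetric \<open>H\<close>.\<close>
definition minimizing_pair ::
    "(real ^ 'n \<Rightarrow> real) \<Rightarrow> real \<Rightarrow> real ^ 'n \<Rightarrow> (real ^ 'n) \<times> (real ^ 'n ^ 'n) \<Rightarrow> bool" where
  "minimizing_pair u h x = is_arg_min (energy u h x) (\<lambda>(G, H). transpose H = H)"

end

theory Submission
  imports Defs
begin

text \<open>
  Put \<open>v z = u (x + z) - u x\<close>.  The problem is a linear least squares problem: \<open>v\<close> is projected, in
  \<open>L\<^sup>2\<close> of the sphere of radius \<open>h\<close>, onto the span of the polynomials \<open>G \<bullet> z + z \<bullet> H z / 2\<close>.  A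
  solution of the normal equations is the minimiser by Pythagoras, and the only one because such a polynomial
  with \<open>(G, H) \<noteq> 0\<close> and \<open>H\<close> symmetric has positive \<open>L\<^sup>2\<close> norm (\<open>residual_pythagoras\<close>, \<open>integral_quad_squared_pos\<close>).

  The normal equations can be solved in closed form because the sphere is isotropic.  A rotation takes any
  direction to any other, so \<open>\<integral> (w \<bullet> z)\<^sup>4\<close> is a multiple of \<open>\<bar>w\<bar>\<^sup>4\<close>, and polarisation gives
  \<open>\<integral> z\<^sub>i z\<^sub>j z\<^sub>k z\<^sub>l = c (\<delta>\<^sub>i\<^sub>j \<delta>\<^sub>k\<^sub>l + \<delta>\<^sub>i\<^sub>k \<delta>\<^sub>j\<^sub>l + \<delta>\<^sub>i\<^sub>l \<delta>\<^sub>j\<^sub>k)\<close> with one constant \<open>c\<close>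
  (\<open>fourth_moment\<close>).  Contracting the indices yields \<open>c\<close> in terms of the area of the sphere.  Since odd
  functions integrate to zero, the equations for \<open>G\<close> and \<open>H\<close> decouple, and the one for \<open>H\<close> reads
  \<open>c (tr H I + 2 H) = 2 \<integral> v z z\<^sup>T\<close>.  It is solved by taking the trace first, and the symmetry
  \<open>z \<mapsto> - z\<close> turns \<open>2 v z\<close> into the second difference \<open>v z + v (- z)\<close> (\<open>lsq_hess_eq_integral\<close>).

  Three facts about Hausdorff measure are needed.  In dimension \<open>d\<close> it is multiplied by \<open>s\<^sup>d\<close> under a
  similarity of ratio \<open>s\<close>, which gives the invariance under rotations and the relation between the spheres of radius \<open>1\<close> and
  \<open>h\<close> (\<open>hausdorff_outer_similarity_image\<close>).  The sphere is not a null set, by projection onto a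
  hyperplane (\<open>hausdorff_outer_sphere_pos\<close>).  Finally the sphere has finite measure, and the coordinates and
  \<open>u\<close> are measurable on it; this is already contained in the integrability of the squared residual for
  all \<open>G\<close> and \<open>H\<close>, by polarisation (\<open>sq_residual_integrable_imp\<close>).
\<close>

section \<open>Hausdorff measure under similarities\<close>

lemma bounded_similarity_image:
  fixes f :: "'a::metric_space \<Rightarrow> 'b::metric_space"
  assumes f: "\<And>x y. dist (f x) (f y) = c * dist x y" and c: "c \<ge> 0" and A: "bounded A"
  shows "bounded (f ` A)"
proof -
  obtain a r where "\<forall>x\<in>A. dist a x \<le> r" using A unfolding bounded_def by blast
  then have "\<forall>x\<in>A. dist (f a) (f x) \<le> c * r" by (simp add: f c mult_left_mono)
  then show ?thesis unfolding bounded_def by blast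
qed

lemma diameter_similarity_image_le:
  fixes f :: "'a::metric_space \<Rightarrow> 'b::metric_space"
  assumes f: "\<And>x y. dist (f x) (f y) = c * dist x y" and c: "c \<ge> 0" and A: "bounded A"
  shows "diameter (f ` A) \<le> c * diameter A"
proof (cases "A = {}")
  case False
  have "dist (f x) (f y) \<le> c * diameter A" if "x \<in> A" "y \<in> A" for x y
    using diameter_bounded_bound[OF A that] c by (simp add: f mult_left_mono)
  then show ?thesis
    using False unfolding diameter_def[of "f ` A"] by (auto intro!: cSUP_least)
qed auto

lemma hausdorff_gauge_similarity_image_le:
  fixes f :: "'a::metric_space \<Rightarrow> 'b::metric_space"
  assumes f: "\<And>x y. dist (f x) (f y) = c * dist x y" and c: "c \<ge> 0" and A: "bounded A"
  shows "hausdorff_gauge d (f ` A) \<le> ennreal (c ^ d) * hausdorff_gauge d A"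
proof -
  have "(diameter (f ` A) / 2) ^ d \<le> (c * (diameter A / 2)) ^ d"
    using diameter_similarity_image_le[OF f c A] diameter_ge_0[OF bounded_similarity_image[OF f c A]] by (intro power_mono) auto
  then have "unit_ball_vol (real d) * (diameter (f ` A) / 2) ^ d
      \<le> c ^ d * (unit_ball_vol (real d) * (diameter A / 2) ^ d)"
    using mult_left_mono[of _ _ "unit_ball_vol (real d)"] unit_ball_vol_pos[of "real d"]
    by (simp only: power_mult_distrib mult.left_commute) simp
  then show ?thesis
    using c by (auto simp: hausdorff_gauge_def ennreal_mult'[symmetric] intro!: ennreal_leI)
qed

lemma hausdorff_premeasure_similarity_image_le:
  fixes f :: "'a::metric_space \<Rightarrow> 'b::metric_space"
  assumes f: "\<And>x y. dist (f x) (f y) = c * dist x y" and c: "c > 0"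
  shows "ennreal (1 / c ^ d) * hausdorff_premeasure d (c * \<delta>) (f ` A) \<le> hausdorff_premeasure d \<delta> A"
  unfolding hausdorff_premeasure_def[of d \<delta>]
proof (rule INF_greatest)
  fix C assume C: "C \<in> fine_covers \<delta> A"
  have bounded: "bounded (C i)" for i using C by (simp add: fine_covers_def)
  have "(\<lambda>i. f ` C i) \<in> fine_covers (c * \<delta>) (f ` A)"
  proof -
    have "bounded (f ` C i)" for i
      using bounded_similarity_image[OF f _ bounded] c by simp
    moreover have "diameter (f ` C i) \<le> c * \<delta>" for i
      using diameter_similarity_image_le[OF f _ bounded, of i] C c
      by (force simp: fine_covers_def intro: order_trans mult_left_mono)
    moreover have "f ` A \<subseteq> (\<Union>i. f ` C i)"
      using C by (auto simp: fine_covers_def image_UN[symmetric])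
    ultimately show ?thesis by (auto simp: fine_covers_def)
  qed
  then have "hausdorff_premeasure d (c * \<delta>) (f ` A) \<le> (\<Sum>i. hausdorff_gauge d (f ` C i))"
    unfolding hausdorff_premeasure_def by (rule INF_lower)
  also have "\<dots> \<le> (\<Sum>i. ennreal (c ^ d) * hausdorff_gauge d (C i))"
    using hausdorff_gauge_similarity_image_le[OF f _ bounded] c by (intro suminf_le) auto
  finally have "ennreal (1 / c ^ d) * hausdorff_premeasure d (c * \<delta>) (f ` A)
      \<le> ennreal (1 / c ^ d) * (ennreal (c ^ d) * (\<Sum>i. hausdorff_gauge d (C i)))"
    by (simp add: mult_left_mono)
  also have "\<dots> = (\<Sum>i. hausdorff_gauge d (C i))"
    using c by (simp add: mult.assoc[symmetric] ennreal_mult'[symmetric] del: ennreal_suminf_cmult)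
  finally show "ennreal (1 / c ^ d) * hausdorff_premeasure d (c * \<delta>) (f ` A)
      \<le> (\<Sum>i. hausdorff_gauge d (C i))" .
qed

text \<open>The scale \<open>\<delta>\<close> of the covers is multiplied by \<open>c\<close> as well, which disappears in the supremum
  over all scales.\<close>
lemma hausdorff_outer_similarity_image_le:
  fixes f :: "'a::metric_space \<Rightarrow> 'b::metric_space"
  assumes f: "\<And>x y. dist (f x) (f y) = c * dist x y" and c: "c > 0"
  shows "hausdorff_outer d (f ` A) \<le> ennreal (c ^ d) * hausdorff_outer d A"
proof -
  have "ennreal (1 / c ^ d) * hausdorff_premeasure d \<delta> (f ` A) \<le> hausdorff_outer d A"
    if "\<delta> > 0" for \<delta>
  proof -
    have "ennreal (1 / c ^ d) * hausdorff_premeasure d \<delta> (f ` A) \<le> hausdorff_premeasure d (\<delta> / c) A"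
      using hausdorff_premeasure_similarity_image_le[OF f c, of d "\<delta> / c" A] c by simp
    also have "\<dots> \<le> hausdorff_outer d A"
      unfolding hausdorff_outer_def using that c by (intro SUP_upper) simp
    finally show ?thesis .
  qed
  then have "ennreal (1 / c ^ d) * hausdorff_outer d (f ` A) \<le> hausdorff_outer d A"
    unfolding hausdorff_outer_def[of d "f ` A"] SUP_mult_left_ennreal by (intro SUP_least) simp
  then have "ennreal (c ^ d) * (ennreal (1 / c ^ d) * hausdorff_outer d (f ` A))
      \<le> ennreal (c ^ d) * hausdorff_outer d A"
    by (rule mult_left_mono) simp
  then show ?thesis
    using c by (simp add: mult.assoc[symmetric] ennreal_mult'[symmetric])
qed

text \<open>Both inequalities are \<open>hausdorff_outer_similarity_image_le\<close>: once for \<open>f\<close>, and once for its inverse, which is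
  a similarity of ratio \<open>1 / c\<close>.\<close>
lemma hausdorff_outer_similarity_image:
  fixes f :: "'a::metric_space \<Rightarrow> 'b::metric_space"
  assumes f: "\<And>x y. dist (f x) (f y) = c * dist x y" and c: "c > 0" and bij: "bij f"
  shows "hausdorff_outer d (f ` A) = ennreal (c ^ d) * hausdorff_outer d A"
proof (rule antisym)
  have inv: "dist (inv f x) (inv f y) = (1 / c) * dist x y" for x y
    using f[of "inv f x" "inv f y"] c by (simp add: bij_is_surj[OF bij] surj_f_inv_f field_simps)
  have "hausdorff_outer d (inv f ` f ` A) \<le> ennreal ((1 / c) ^ d) * hausdorff_outer d (f ` A)"
    by (rule hausdorff_outer_similarity_image_le[OF inv]) (use c in simp)
  then have "hausdorff_outer d A \<le> ennreal ((1 / c) ^ d) * hausdorff_outer d (f ` A)"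
    by (simp add: image_inv_f_f bij_is_inj[OF bij])
  then have "ennreal (c ^ d) * hausdorff_outer d A
      \<le> ennreal (c ^ d) * (ennreal ((1 / c) ^ d) * hausdorff_outer d (f ` A))"
    by (rule mult_left_mono) simp
  then show "ennreal (c ^ d) * hausdorff_outer d A \<le> hausdorff_outer d (f ` A)"
    using c by (simp add: mult.assoc[symmetric] ennreal_mult'[symmetric] power_mult_distrib[symmetric])
qed (rule hausdorff_outer_similarity_image_le[OF f c])

text \<open>The Caratheodory condition for \<open>A\<close>, tested on \<open>f ` X\<close>, is \<open>c ^ d\<close> times the one for \<open>f -` A\<close>,
  tested on \<open>X\<close>.\<close>
lemma similarity_vimage_in_sets_hausdorff_measure:
  fixes f :: "'a::metric_space \<Rightarrow> 'b::metric_space"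
  assumes f: "\<And>x y. dist (f x) (f y) = c * dist x y" and c: "c > 0" and bij: "bij f"
    and A: "A \<in> sets (hausdorff_measure d)"
  shows "f -` A \<in> sets (hausdorff_measure d)"
proof -
  note image = hausdorff_outer_similarity_image[OF f c bij, of d]
  have A': "hausdorff_outer d (A \<inter> Y) + hausdorff_outer d ((UNIV - A) \<inter> Y) = hausdorff_outer d Y" for Y
    using A by (simp add: sets_hausdorff_measure lambda_system_def)
  have "hausdorff_outer d (f -` A \<inter> X) + hausdorff_outer d ((UNIV - f -` A) \<inter> X)
      = hausdorff_outer d X" for X
  proof -
    have "f ` (f -` A \<inter> X) = A \<inter> f ` X" "f ` ((UNIV - f -` A) \<inter> X) = (UNIV - A) \<inter> f ` X"
      by auto
    then have "ennreal (c ^ d) * (hausdorff_outer d (f -` A \<inter> X) + hausdorff_outer d ((UNIV - f -` A) \<inter> X))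
        = ennreal (c ^ d) * hausdorff_outer d X"
      using A'[of "f ` X"] by (simp add: distrib_left flip: image)
    then show ?thesis using c by (simp add: ennreal_mult_cancel_left)
  qed
  then show ?thesis by (simp add: sets_hausdorff_measure lambda_system_def)
qed

section \<open>The sphere is not a null set\<close>

lemma emeasure_lborel_prism:
  fixes p :: "real ^ 'n" and a :: 'n
  assumes "s \<ge> 0"
  shows "emeasure lborel (cbox (\<chi> j. if j = a then 0 else p $ j - s) (\<chi> j. if j = a then 1 else p $ j + s))
    = ennreal ((2 * s) ^ (CARD('n) - 1))"
proof -
  let ?l = "\<chi> j. if j = a then 0 else p $ j - s" and ?u = "\<chi> j. if j = a then 1 else p $ j + s"
  have ne: "cbox ?l ?u \<noteq> {}"
  proof -
    have "(\<chi> j. if j = a then 0 else p $ j) \<in> cbox ?l ?u" using assms by (simp add: mem_box_cart)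
    then show ?thesis by blast
  qed
  have "emeasure lborel (cbox ?l ?u) = ennreal (measure lborel (cbox ?l ?u))"
    by (intro emeasure_eq_ennreal_measure) (use emeasure_lborel_cbox_finite[of ?l ?u] in auto)
  also have "measure lborel (cbox ?l ?u) = (\<Prod>j\<in>UNIV. if j = a then 1 else 2 * s)"
    unfolding content_cbox_cart[OF ne] by (intro prod.cong) auto
  also have "\<dots> = (2 * s) ^ (CARD('n) - 1)"
    by (simp add: prod.If_cases Collect_neg_eq[symmetric] card_Diff_subset Compl_eq_Diff_UNIV)
  finally show ?thesis .
qed

lemma norm_squared_cart: "(norm (x :: real ^ 'n))\<^sup>2 = (\<Sum>i\<in>UNIV. (x $ i)\<^sup>2)"
  by (simp add: norm_vec_def L2_set_def sum_nonneg)

text \<open>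
  Forgetting one coordinate \<open>a\<close> does not increase diameters and maps the sphere onto a disc of dimension
  \<open>N - 1\<close>.  To compare with Lebesgue measure on \<open>\<real>\<^sup>N\<close> itself, each projected set is thickened
  to height \<open>1\<close> in the forgotten direction: a set of diameter \<open>s\<close> then lies in a prism of volume
  \<open>(2 s)\<^sup>N\<^sup>-\<^sup>1\<close>, a multiple of its gauge, and the prisms of a cover contain a fixed prism over a cube
  inscribed in the disc.
\<close>
lemma hausdorff_outer_sphere_pos:
  fixes r :: real
  assumes r: "r > 0"
  shows "hausdorff_outer (CARD('n) - 1) (sphere (0 :: real ^ 'n) r) > 0"
proof -
  let ?d = "CARD('n) - 1"
  define a :: 'n where "a = undefined"
  define N where "N = real CARD('n)"
  have N: "N > 0" by (simp add: N_def)
  define prism :: "real ^ 'n \<Rightarrow> real \<Rightarrow> (real ^ 'n) set" where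
    "prism p s = cbox (\<chi> j. if j = a then 0 else p $ j - s) (\<chi> j. if j = a then 1 else p $ j + s)" for p s
  have mem_prism: "y \<in> prism p s \<longleftrightarrow> 0 \<le> y $ a \<and> y $ a \<le> 1 \<and> (\<forall>j. j \<noteq> a \<longrightarrow> \<bar>y $ j - p $ j\<bar> \<le> s)" for y p s
    unfolding prism_def mem_box_cart by (auto simp: abs_le_iff algebra_simps split: if_splits) 
  \<comment> \<open>\<open>V\<close> is the volume of the prism over the inscribed cube, \<open>K\<close> the ratio between the volume
    \<open>(2 s)\<^sup>N\<^sup>-\<^sup>1\<close> of a prism and the gauge of a set of diameter \<open>s\<close>.\<close>
  define V where "V = (2 * (r / N)) ^ ?d"
  define K where "K = 4 ^ ?d / unit_ball_vol (real ?d)"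
  have V: "V > 0" using r N by (simp add: V_def)
  have K: "K > 0" by (simp add: K_def)
  have bound: "ennreal V \<le> ennreal K * (\<Sum>i. hausdorff_gauge ?d (C i))"
    if C: "C \<in> fine_covers 1 (sphere (0 :: real ^ 'n) r)" for C
  proof -
    have cover: "sphere 0 r \<subseteq> (\<Union>i. C i)" and bdd: "\<And>i. bounded (C i)"
      using C by (auto simp: fine_covers_def)
    \<comment> \<open>An empty member of the cover has gauge \<open>0\<close> but may not be replaced by a degenerate prism, whose
      volume is \<open>1\<close> if \<open>N = 1\<close>.\<close>
    define B where "B i = (if C i = {} then {} else prism (SOME p. p \<in> C i) (diameter (C i)))" for i
    have "prism 0 (r / N) \<subseteq> (\<Union>i. B i)"
    proof
      fix y assume y: "y \<in> prism 0 (r / N)"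
      let ?S = "\<Sum>j\<in>UNIV - {a}. (y $ j)\<^sup>2"
      \<comment> \<open>The point of the sphere above the projection of \<open>y\<close>.\<close>
      define z where "z = (\<chi> j. if j = a then sqrt (r\<^sup>2 - ?S) else y $ j)"
      have "?S \<le> r\<^sup>2"
      proof -
        let ?w = "\<chi> j. if j = a then 0 else y $ j"
        have "?S = (\<Sum>j\<in>UNIV. (?w $ j)\<^sup>2)"
          by (intro sum.mono_neutral_cong_left) auto
        also have "\<dots> = (norm ?w)\<^sup>2"
          by (rule norm_squared_cart[symmetric])
        also have "norm ?w \<le> (\<Sum>j\<in>UNIV. \<bar>?w $ j\<bar>)" by (rule norm_le_l1_cart)
        then have "norm ?w \<le> (\<Sum>j\<in>(UNIV::'n set). r / N)"
        proof (rule order_trans)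
          show "(\<Sum>j\<in>UNIV. \<bar>?w $ j\<bar>) \<le> (\<Sum>j\<in>(UNIV::'n set). r / N)"
            by (rule sum_mono) (use y r N in \<open>simp add: mem_prism\<close>)
        qed
        then have "norm ?w \<le> r" using N by (simp add: N_def)
        then have "(norm ?w)\<^sup>2 \<le> r\<^sup>2" by (intro power_mono) auto
        finally show ?thesis .
      qed
      then have "(\<Sum>j\<in>UNIV. (z $ j)\<^sup>2) = r\<^sup>2"
        unfolding sum.remove[OF finite UNIV_I[of a]] by (simp add: z_def)
      then have "(norm z)\<^sup>2 = r\<^sup>2"
        by (simp only: norm_squared_cart)
      then have "z \<in> sphere 0 r" using r by (simp add: power2_eq_iff_nonneg)
      then obtain i where i: "z \<in> C i" using cover by blast
      have "(SOME p. p \<in> C i) \<in> C i" using i by (rule someI)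
      then have "dist z (SOME p. p \<in> C i) \<le> diameter (C i)"
        by (rule diameter_bounded_bound[OF bdd i])
      then have "\<bar>z $ j - (SOME p. p \<in> C i) $ j\<bar> \<le> diameter (C i)" for j
        using component_le_norm_cart[of "z - (SOME p. p \<in> C i)" j] by (simp add: dist_norm)
      moreover have "z $ j = y $ j" if "j \<noteq> a" for j using that by (simp add: z_def)
      ultimately have "y \<in> prism (SOME p. p \<in> C i) (diameter (C i))"
        using y unfolding mem_prism by metis
      then show "y \<in> (\<Union>i. B i)" using i by (auto simp: B_def)
    qed
    then have "emeasure lborel (prism 0 (r / N)) \<le> emeasure lborel (\<Union>i. B i)"
      by (rule emeasure_mono) (auto simp: B_def prism_def)
    also have "\<dots> \<le> (\<Sum>i. emeasure lborel (B i))"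
      by (rule emeasure_subadditive_countably) (auto simp: B_def prism_def)
    also have "\<dots> \<le> (\<Sum>i. ennreal K * hausdorff_gauge ?d (C i))"
    proof (rule suminf_le)
      fix i
      have "emeasure lborel (prism p (diameter (C i)))
          = ennreal K * ennreal (unit_ball_vol (real ?d) * (diameter (C i) / 2) ^ ?d)" for p
      proof -
        have "emeasure lborel (prism p (diameter (C i))) = ennreal ((2 * diameter (C i)) ^ ?d)"
          unfolding prism_def by (rule emeasure_lborel_prism) (rule diameter_ge_0[OF bdd])
        also have "2 * diameter (C i) = 4 * (diameter (C i) / 2)" by simp
        also have "\<dots> ^ ?d = K * (unit_ball_vol (real ?d) * (diameter (C i) / 2) ^ ?d)"
        proof -
          have "unit_ball_vol (real ?d) \<noteq> 0"
            using unit_ball_vol_pos[of "real ?d"] by (metis of_nat_0_le_iff less_irrefl)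
          then show ?thesis unfolding K_def power_mult_distrib by simp
        qed
        finally show ?thesis using K by (simp add: ennreal_mult')
      qed
      then show "emeasure lborel (B i) \<le> ennreal K * hausdorff_gauge ?d (C i)"
        by (simp add: B_def hausdorff_gauge_def)
    qed auto
    finally show ?thesis
      using emeasure_lborel_prism[of "r / N" a 0] r N by (simp add: prism_def V_def)
  qed
  have "ennreal (1 / K) * ennreal V \<le> (\<Sum>i. hausdorff_gauge ?d (C i))"
    if "C \<in> fine_covers 1 (sphere (0 :: real ^ 'n) r)" for C
  proof -
    have "ennreal (1 / K) * ennreal V \<le> ennreal (1 / K) * (ennreal K * (\<Sum>i. hausdorff_gauge ?d (C i)))"
      by (rule mult_left_mono[OF bound[OF that]]) simp
    then show ?thesis using K by (simp add: mult.assoc[symmetric] ennreal_mult'[symmetric])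
  qed
  then have "ennreal (1 / K) * ennreal V \<le> hausdorff_premeasure ?d 1 (sphere (0 :: real ^ 'n) r)"
    unfolding hausdorff_premeasure_def by (rule INF_greatest)
  also have "\<dots> \<le> hausdorff_outer ?d (sphere (0 :: real ^ 'n) r)"
    unfolding hausdorff_outer_def by (intro SUP_upper) simp
  finally have "ennreal (1 / K) * ennreal V \<le> hausdorff_outer ?d (sphere (0 :: real ^ 'n) r)" .
  moreover have "0 < ennreal (1 / K) * ennreal V" using K V by (simp add: ennreal_zero_less_mult_iff)
  ultimately show ?thesis by simp
qed

section \<open>Moments of a rotation invariant measure on a sphere\<close>

lemma sum_axis_inner: "(\<Sum>k\<in>UNIV. (axis k 1 \<bullet> w) * (axis k 1 \<bullet> y)) = w \<bullet> (y :: real ^ 'n)"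
  by (simp add: inner_axis' inner_vec_def[of w])

lemma axis_inner_axis: "axis i 1 \<bullet> (axis j 1 :: real ^ 'n) = (if i = j then 1 else 0)"
  by (simp add: inner_axis_axis)

lemma quadratic_form_eq_sum:
  "z \<bullet> (K *v z) = (\<Sum>k\<in>UNIV. \<Sum>l\<in>UNIV. K $ k $ l * (z $ k * (z :: real ^ 'n) $ l))"
  by (simp add: inner_vec_def matrix_vector_mult_def sum_distrib_left ac_simps)

lemma matrix_vector_mult_minus_right: "K *v (- z) = - (K *v (z :: real ^ 'n))"
  by (rule linear_neg[OF matrix_vector_mul_linear])

text \<open>
  Measurability of the identity is assumed, and not \<open>sets M = sets (restrict_space borel _)\<close>, because the
  measurable sets of Hausdorff measure are not only the Borel sets.
\<close>
locale isotropic_sphere_measure = finite_measure M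
  for M :: "(real ^ 'n) measure" +
  fixes r :: real
  assumes space_eq: "space M = sphere 0 r"
    and radius_pos: "r > 0"
    and id_measurable: "(\<lambda>z. z) \<in> borel_measurable M"
    and orthogonal_measurable: "\<And>f. orthogonal_transformation f \<Longrightarrow> f \<in> measurable M M"
    and distr_orthogonal: "\<And>f. orthogonal_transformation f \<Longrightarrow> distr M M f = M"
    and mass_pos: "measure M (space M) > 0"
begin

text \<open>If \<open>N \<ge> 2\<close>, this is \<open>\<integral> z\<^sub>i\<^sup>2 z\<^sub>j\<^sup>2\<close> for \<open>i \<noteq> j\<close>, by \<open>fourth_moment\<close>; if \<open>N = 1\<close>, it is a
  third of \<open>\<integral> z\<^sup>4\<close>.\<close>
definition mixed_moment :: real where
  "mixed_moment = r ^ 4 * measure M (space M) / (real CARD('n) * (real CARD('n) + 2))"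

lemma mixed_moment_pos: "mixed_moment > 0"
  using radius_pos mass_pos by (simp add: mixed_moment_def)

lemma inner_self: "z \<in> space M \<Longrightarrow> z \<bullet> z = r\<^sup>2"
  by (simp add: space_eq flip: power2_norm_eq_inner)

lemma continuous_measurable:
  assumes "continuous_on UNIV (p :: real ^ 'n \<Rightarrow> real)"
  shows "p \<in> borel_measurable M"
  using measurable_compose[OF id_measurable borel_measurable_continuous_onI[OF assms]] .

lemma continuous_bounded:
  assumes "continuous_on UNIV (p :: real ^ 'n \<Rightarrow> real)"
  obtains B where "\<And>z. z \<in> space M \<Longrightarrow> \<bar>p z\<bar> \<le> B"
proof -
  have "bounded (p ` sphere 0 r)"
    by (intro compact_imp_bounded compact_continuous_image continuous_on_subset[OF assms]) auto
  then obtain B where "\<forall>z\<in>sphere 0 r. \<bar>p z\<bar> \<le> B" by (auto simp: bounded_real)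
  then show ?thesis by (intro that[of B]) (simp add: space_eq)
qed

lemma integrable_continuous:
  assumes "continuous_on UNIV (p :: real ^ 'n \<Rightarrow> real)"
  shows "integrable M p"
proof -
  obtain B where "\<And>z. z \<in> space M \<Longrightarrow> \<bar>p z\<bar> \<le> B" using continuous_bounded[OF assms] by blast
  then show ?thesis
    by (intro integrable_const_bound[of _ B] AE_I2 continuous_measurable[OF assms]) simp
qed

lemma integral_orthogonal:
  fixes g :: "real ^ 'n \<Rightarrow> real"
  assumes "orthogonal_transformation f" and "g \<in> borel_measurable M"
  shows "(LINT z|M. g (f z)) = (LINT z|M. g z)"
  using integral_distr[OF orthogonal_measurable[OF assms(1)] assms(2)] distr_orthogonal[OF assms(1)]
  by simp

lemma orthogonal_uminus: "orthogonal_transformation (uminus :: real ^ 'n \<Rightarrow> real ^ 'n)"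
  by (simp add: orthogonal_transformation_def linear_uminus)

lemma integral_reflect:
  fixes g :: "real ^ 'n \<Rightarrow> real"
  assumes "g \<in> borel_measurable M"
  shows "(LINT z|M. g (- z)) = (LINT z|M. g z)"
  by (rule integral_orthogonal[OF orthogonal_uminus assms])

text \<open>
  The fourth moment in direction \<open>w\<close> depends on \<open>\<bar>w\<bar>\<close> only, because a rotation takes any \<open>w\<close> to a
  multiple of one fixed unit vector.  The fourth moments in all directions determine the symmetric
  4-tensor of moments, by polarisation.  With the factor \<open>3\<close>, the constant \<open>c\<close> becomes the common
  coefficient of the three pairings of indices in that tensor.
\<close>
lemma fourth_moment_direction: "\<exists>c. \<forall>w. (LINT z|M. (w \<bullet> z) ^ 4) = 3 * c * (w \<bullet> w)\<^sup>2"
proof -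
  define e :: "real ^ 'n" where "e = axis undefined 1"
  have e: "norm e = 1" by (simp add: e_def norm_axis_1)
  have "(LINT z|M. (w \<bullet> z) ^ 4) = (LINT z|M. (e \<bullet> z) ^ 4) * (w \<bullet> w)\<^sup>2" for w
  proof -
    have "norm (norm w *\<^sub>R e) = norm w" by (simp add: e)
    then obtain f where f: "orthogonal_transformation f" "f (norm w *\<^sub>R e) = w"
      using orthogonal_transformation_exists by blast
    have "(LINT z|M. (w \<bullet> z) ^ 4) = (LINT z|M. (w \<bullet> f z) ^ 4)"
      by (rule integral_orthogonal[OF f(1), symmetric])
         (intro continuous_measurable continuous_intros)
    also have "\<dots> = (LINT z|M. norm w ^ 4 * (e \<bullet> z) ^ 4)"
    proof -
      have "w \<bullet> f z = norm w * (e \<bullet> z)" for z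
      proof -
        have "w \<bullet> f z = f (norm w *\<^sub>R e) \<bullet> f z" by (simp add: f(2))
        also have "\<dots> = (norm w *\<^sub>R e) \<bullet> z" using f(1) by (simp add: orthogonal_transformation_def)
        finally show ?thesis by simp
      qed
      then show ?thesis by (simp add: power_mult_distrib)
    qed
    also have "\<dots> = (LINT z|M. (e \<bullet> z) ^ 4) * norm w ^ 4" by simp
    also have "norm w ^ 4 = (w \<bullet> w)\<^sup>2"
      by (simp add: power2_norm_eq_inner[symmetric])
    finally show ?thesis .
  qed
  then have "(LINT z|M. (w \<bullet> z) ^ 4) = 3 * ((LINT z|M. (e \<bullet> z) ^ 4) / 3) * (w \<bullet> w)\<^sup>2" for w
    by (metis nonzero_mult_div_cancel_left times_divide_eq_right zero_neq_numeral)
  then show ?thesis by blast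
qed

text \<open>
  Three polarisation steps: the value of \<open>(w \<bullet> z)\<^sup>2 (p \<bullet> z)\<^sup>2\<close> follows from
  \<open>(s + t)\<^sup>4 + (s - t)\<^sup>4 = 2 s\<^sup>4 + 12 s\<^sup>2 t\<^sup>2 + 2 t\<^sup>4\<close>, and then each of the two squares is split by
  \<open>(s + t)\<^sup>2 - (s - t)\<^sup>2 = 4 s t\<close>.
\<close>
lemma fourth_moment_polarised:
  assumes q: "\<And>w. (LINT z|M. (w \<bullet> z) ^ 4) = 3 * c * (w \<bullet> w)\<^sup>2"
  shows "(LINT z|M. (w \<bullet> z) * (y \<bullet> z) * ((p \<bullet> z) * (s \<bullet> z)))
    = c * ((w \<bullet> y) * (p \<bullet> s) + (w \<bullet> p) * (y \<bullet> s) + (w \<bullet> s) * (y \<bullet> p))"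
proof -
  have int: "integrable M (\<lambda>z. (w \<bullet> z) * (y \<bullet> z) * ((p \<bullet> z) * (s \<bullet> z)))" for w y p s
    by (intro integrable_continuous continuous_intros)
  have int4: "integrable M (\<lambda>z. (w \<bullet> z) ^ 4)" for w
    by (intro integrable_continuous continuous_intros)
  have 1: "(LINT z|M. (w \<bullet> z) * (w \<bullet> z) * ((p \<bullet> z) * (p \<bullet> z)))
    = c * ((w \<bullet> w) * (p \<bullet> p) + 2 * (w \<bullet> p)\<^sup>2)" for w p
  proof -
    have "(LINT z|M. 12 * ((w \<bullet> z) * (w \<bullet> z) * ((p \<bullet> z) * (p \<bullet> z))))
        = (LINT z|M. ((w + p) \<bullet> z) ^ 4 + ((w - p) \<bullet> z) ^ 4 - 2 * (w \<bullet> z) ^ 4 - 2 * (p \<bullet> z) ^ 4)"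
      by (intro Bochner_Integration.integral_cong refl)
         (simp only: inner_add_left inner_diff_left, algebra)
    also have "\<dots> = 3 * c * (((w + p) \<bullet> (w + p))\<^sup>2 + ((w - p) \<bullet> (w - p))\<^sup>2
        - 2 * (w \<bullet> w)\<^sup>2 - 2 * (p \<bullet> p)\<^sup>2)"
      unfolding right_diff_distrib distrib_left
      by (simp add: int4 q)
    also have "\<dots> = 12 * (c * ((w \<bullet> w) * (p \<bullet> p) + 2 * (w \<bullet> p)\<^sup>2))"
      unfolding inner_add_left inner_add_right inner_diff_left inner_diff_right inner_commute[of p w]
      by algebra
    finally show ?thesis by (simp add: int)
  qed
  have 2: "(LINT z|M. (w \<bullet> z) * (w \<bullet> z) * ((p \<bullet> z) * (s \<bullet> z)))
    = c * ((w \<bullet> w) * (p \<bullet> s) + 2 * (w \<bullet> p) * (w \<bullet> s))" for w p s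
  proof -
    have "(LINT z|M. 4 * ((w \<bullet> z) * (w \<bullet> z) * ((p \<bullet> z) * (s \<bullet> z))))
        = (LINT z|M. (w \<bullet> z) * (w \<bullet> z) * (((p + s) \<bullet> z) * ((p + s) \<bullet> z))
            - (w \<bullet> z) * (w \<bullet> z) * (((p - s) \<bullet> z) * ((p - s) \<bullet> z)))"
      by (intro Bochner_Integration.integral_cong refl)
         (simp only: inner_add_left inner_diff_left, algebra)
    also have "\<dots> = 4 * (c * ((w \<bullet> w) * (p \<bullet> s) + 2 * (w \<bullet> p) * (w \<bullet> s)))"
      unfolding Bochner_Integration.integral_diff[OF int int] 1
      unfolding inner_add_left inner_add_right inner_diff_left inner_diff_right inner_commute[of s p]
      by algebra
    finally show ?thesis by (simp add: int)
  qed
  have "(LINT z|M. 4 * ((w \<bullet> z) * (y \<bullet> z) * ((p \<bullet> z) * (s \<bullet> z))))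
      = (LINT z|M. ((w + y) \<bullet> z) * ((w + y) \<bullet> z) * ((p \<bullet> z) * (s \<bullet> z))
          - ((w - y) \<bullet> z) * ((w - y) \<bullet> z) * ((p \<bullet> z) * (s \<bullet> z)))"
    by (intro Bochner_Integration.integral_cong refl)
       (simp only: inner_add_left inner_diff_left, algebra)
  also have "\<dots> = 4 * (c * ((w \<bullet> y) * (p \<bullet> s) + (w \<bullet> p) * (y \<bullet> s) + (w \<bullet> s) * (y \<bullet> p)))"
    unfolding Bochner_Integration.integral_diff[OF int int] 2
    unfolding inner_add_left inner_add_right inner_diff_left inner_diff_right inner_commute[of y w]
    by algebra
  finally show ?thesis by (simp add: int)
qed

text \<open>Summing a pair of indices of the fourth moments contracts \<open>\<bar>z\<bar>\<^sup>2 = r\<^sup>2\<close>: once this gives the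
  second moments, twice the total mass, which identifies the constant \<open>c\<close>.\<close>
lemma second_moment_polarised:
  assumes q: "\<And>w. (LINT z|M. (w \<bullet> z) ^ 4) = 3 * c * (w \<bullet> w)\<^sup>2"
  shows "r\<^sup>2 * (LINT z|M. (w \<bullet> z) * (y \<bullet> z)) = c * (real CARD('n) + 2) * (w \<bullet> y)"
proof -
  have int: "integrable M (\<lambda>z. (w \<bullet> z) * (y \<bullet> z) * ((p \<bullet> z) * (s \<bullet> z)))" for p s
    by (intro integrable_continuous continuous_intros)
  have "r\<^sup>2 * (LINT z|M. (w \<bullet> z) * (y \<bullet> z)) = (LINT z|M. (w \<bullet> z) * (y \<bullet> z) * (z \<bullet> z))"
    by (subst Bochner_Integration.integral_cong[OF refl, where g = "\<lambda>z. r\<^sup>2 * ((w \<bullet> z) * (y \<bullet> z))"])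
       (simp_all add: inner_self)
  also have "\<dots> = (LINT z|M. (\<Sum>k\<in>UNIV. (w \<bullet> z) * (y \<bullet> z) * ((axis k 1 \<bullet> z) * (axis k 1 \<bullet> z))))"
    by (simp add: sum_distrib_left[symmetric] sum_axis_inner)
  also have "\<dots> = (\<Sum>k\<in>UNIV. c * ((w \<bullet> y) + 2 * ((axis k 1 \<bullet> w) * (axis k 1 \<bullet> y))))"
    unfolding Bochner_Integration.integral_sum[OF int] fourth_moment_polarised[OF q]
    by (simp add: inner_axis inner_axis' add.commute)
  also have "\<dots> = c * (real CARD('n) + 2) * (w \<bullet> y)"
    by (simp add: sum_distrib_left[symmetric] sum.distrib sum_axis_inner algebra_simps)
  finally show ?thesis .
qed

lemma fourth_moment_constant:
  assumes q: "\<And>w. (LINT z|M. (w \<bullet> z) ^ 4) = 3 * c * (w \<bullet> w)\<^sup>2"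
  shows "c = mixed_moment"
proof -
  have int: "integrable M (\<lambda>z. (p \<bullet> z) * (s \<bullet> z))" for p s
    by (intro integrable_continuous continuous_intros)
  have "r ^ 4 * measure M (space M) = r\<^sup>2 * (LINT z|M. r\<^sup>2)" by (simp add: power4_eq_xxxx power2_eq_square)
  also have "(LINT z|M. r\<^sup>2) = (LINT z|M. (\<Sum>k\<in>UNIV. (axis k 1 \<bullet> z) * (axis k 1 \<bullet> z)))"
    unfolding sum_axis_inner by (intro Bochner_Integration.integral_cong refl) (simp add: inner_self)
  also have "\<dots> = (\<Sum>k\<in>UNIV. (LINT z|M. (axis k 1 \<bullet> z) * (axis k 1 \<bullet> z)))"
    by (rule Bochner_Integration.integral_sum[OF int])
  also have "r\<^sup>2 * \<dots> = c * (real CARD('n) + 2) * real CARD('n)"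
    unfolding sum_distrib_left second_moment_polarised[OF q] by (simp add: inner_axis_axis)
  finally have "r ^ 4 * measure M (space M) = c * (real CARD('n) * (real CARD('n) + 2))" by simp
  then show ?thesis
    unfolding mixed_moment_def by (simp only:) (rule nonzero_mult_div_cancel_right[symmetric], simp)
qed

lemma fourth_moment:
  "(LINT z|M. (w \<bullet> z) * (y \<bullet> z) * ((p \<bullet> z) * (s \<bullet> z)))
    = mixed_moment * ((w \<bullet> y) * (p \<bullet> s) + (w \<bullet> p) * (y \<bullet> s) + (w \<bullet> s) * (y \<bullet> p))"
proof -
  obtain c where q: "\<And>w. (LINT z|M. (w \<bullet> z) ^ 4) = 3 * c * (w \<bullet> w)\<^sup>2"
    using fourth_moment_direction by blast
  show ?thesis using fourth_moment_polarised[OF q] unfolding fourth_moment_constant[OF q] .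
qed

lemma second_moment:
  "(LINT z|M. (w \<bullet> z) * (y \<bullet> z)) = mixed_moment * (real CARD('n) + 2) / r\<^sup>2 * (w \<bullet> y)"
proof -
  obtain c where q: "\<And>w. (LINT z|M. (w \<bullet> z) ^ 4) = 3 * c * (w \<bullet> w)\<^sup>2"
    using fourth_moment_direction by blast
  show ?thesis using second_moment_polarised[OF q, of w y] radius_pos
    unfolding fourth_moment_constant[OF q] by (simp add: field_simps)
qed

lemma fourth_moment_cart:
  "(LINT z|M. z $ i * z $ j * (z $ k * z $ l))
    = mixed_moment * ((if i = j then 1 else 0) * (if k = l then 1 else 0)
        + (if i = k then 1 else 0) * (if j = l then 1 else 0)
        + (if i = l then 1 else 0) * (if j = k then 1 else 0))"
  using fourth_moment[of "axis i 1" "axis j 1" "axis k 1" "axis l 1"]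
  unfolding axis_inner_axis by (simp add: inner_axis')

lemma fourth_moment_quadratic_form:
  "(LINT z|M. z $ i * z $ j * (z \<bullet> (K *v z)))
    = mixed_moment * ((if i = j then trace K else 0) + K $ i $ j + K $ j $ i)"
proof -
  have int: "integrable M (\<lambda>z. z $ i * z $ j * (z $ k * z $ l))" for k l
    by (intro integrable_continuous continuous_intros)
  have "(LINT z|M. z $ i * z $ j * (z \<bullet> (K *v z)))
      = (LINT z|M. (\<Sum>k\<in>UNIV. \<Sum>l\<in>UNIV. K $ k $ l * (z $ i * z $ j * (z $ k * z $ l))))"
    by (simp add: quadratic_form_eq_sum sum_distrib_left ac_simps)
  also have "\<dots> = (\<Sum>k\<in>UNIV. \<Sum>l\<in>UNIV. K $ k $ l * (LINT z|M. z $ i * z $ j * (z $ k * z $ l)))"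
    by (simp add: int)
  also have "\<dots> = mixed_moment * ((if i = j then trace K else 0) + K $ i $ j + K $ j $ i)"
  proof -
    have pull: "(\<Sum>l\<in>UNIV. if P then g l else 0) = (if P then (\<Sum>l\<in>UNIV. g l) else 0)"
      for P and g :: "'n \<Rightarrow> real" by simp
    have "K $ k $ l * (LINT z|M. z $ i * z $ j * (z $ k * z $ l))
        = (if k = l then if i = j then mixed_moment * K $ k $ k else 0 else 0)
          + (if i = k then if j = l then mixed_moment * K $ i $ j else 0 else 0)
          + (if j = k then if i = l then mixed_moment * K $ j $ i else 0 else 0)" for k l
      unfolding fourth_moment_cart by (simp add: algebra_simps)
    then show ?thesis
      by (simp add: sum.distrib pull trace_def distrib_left sum_distrib_left cong: if_cong)
  qed
  finally show ?thesis .
qed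

end

section \<open>Least squares fitting of a quadratic polynomial on the sphere\<close>

definition quad :: "real ^ 'n \<Rightarrow> real ^ 'n ^ 'n \<Rightarrow> real ^ 'n \<Rightarrow> real" where
  "quad G H z = G \<bullet> z + 1 / 2 * (z \<bullet> (H *v z))"

lemma continuous_on_quad [continuous_intros]: "continuous_on S (quad G H)"
  unfolding quad_def by (intro continuous_intros)

lemma quad_diff: "quad (G - G') (H - H') z = quad G H z - quad G' H' z"
  by (simp add: quad_def inner_diff_left inner_diff_right matrix_vector_mult_diff_rdistrib algebra_simps)

lemma symmetric_matrix_nth: "transpose H = H \<Longrightarrow> H $ j $ i = H $ i $ j"
  by (metis transpose_def vec_lambda_beta)

context isotropic_sphere_measure
begin

lemma integral_odd:
  fixes g :: "real ^ 'n \<Rightarrow> real"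
  assumes "continuous_on UNIV g" and "\<And>z. g (- z) = - g z"
  shows "(LINT z|M. g z) = 0"
  using integral_reflect[OF continuous_measurable[OF assms(1)]] assms(2) by simp

text \<open>The bound is \<open>\<bar>v\<bar> \<le> 1 + v\<^sup>2\<close>; the measure is finite and \<open>p\<close> is bounded on the sphere.\<close>
lemma integrable_times_continuous:
  fixes v p :: "real ^ 'n \<Rightarrow> real"
  assumes v: "v \<in> borel_measurable M" and v2: "integrable M (\<lambda>z. (v z)\<^sup>2)"
    and p: "continuous_on UNIV p"
  shows "integrable M (\<lambda>z. v z * p z)"
proof -
  obtain B where B: "\<And>z. z \<in> space M \<Longrightarrow> \<bar>p z\<bar> \<le> B" using continuous_bounded[OF p] by blast
  have "integrable M (\<lambda>z. B * (1 + (v z)\<^sup>2))" using v2 by simp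
  then show ?thesis
  proof (rule Bochner_Integration.integrable_bound)
    show "(\<lambda>z. v z * p z) \<in> borel_measurable M"
      using v continuous_measurable[OF p] by measurable
    have "\<bar>v z * p z\<bar> \<le> \<bar>B * (1 + (v z)\<^sup>2)\<bar>" if z: "z \<in> space M" for z
    proof -
      have "0 \<le> (\<bar>v z\<bar> - 1)\<^sup>2 + v z * v z" by simp
      then have "\<bar>v z\<bar> \<le> 1 + (v z)\<^sup>2" by (simp add: power2_eq_square algebra_simps)
      then have "\<bar>p z\<bar> * \<bar>v z\<bar> \<le> B * (1 + (v z)\<^sup>2)"
        using B[OF z] by (intro mult_mono) auto
      moreover have "B * (1 + (v z)\<^sup>2) \<le> \<bar>B * (1 + (v z)\<^sup>2)\<bar>" by (rule abs_ge_self)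
      ultimately have "\<bar>p z\<bar> * \<bar>v z\<bar> \<le> \<bar>B * (1 + (v z)\<^sup>2)\<bar>" by (rule order_trans)
      then show ?thesis by (simp only: abs_mult mult.commute[of "\<bar>v z\<bar>"])
    qed
    then show "AE z in M. norm (v z * p z) \<le> norm (B * (1 + (v z)\<^sup>2))"
      by (intro AE_I2) simp
  qed
qed

text \<open>
  The solution of the normal equations for \<open>v\<close>.  The second moments are a multiple of the identity,
  so the gradient is a multiple of \<open>\<integral> v z\<close>.  The fourth moments send a symmetric \<open>H\<close> to
  \<open>\<integral> (z \<bullet> H z) z z\<^sup>T = mixed_moment (tr H I + 2 H)\<close>.  Equating this with \<open>2 \<integral> v z z\<^sup>T\<close> and
  taking the trace gives \<open>tr H\<close>, and subtracting it gives \<open>H\<close>.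
\<close>
definition lsq_grad :: "(real ^ 'n \<Rightarrow> real) \<Rightarrow> real ^ 'n" where
  "lsq_grad v = (\<chi> i. r\<^sup>2 / (mixed_moment * (real CARD('n) + 2)) * (LINT z|M. v z * z $ i))"

definition lsq_hess :: "(real ^ 'n \<Rightarrow> real) \<Rightarrow> real ^ 'n ^ 'n" where
  "lsq_hess v = (\<chi> i j. ((LINT z|M. v z * (z $ i * z $ j))
     - (if i = j then r\<^sup>2 * (LINT z|M. v z) / (real CARD('n) + 2) else 0)) / mixed_moment)"

lemma transpose_lsq_hess: "transpose (lsq_hess v) = lsq_hess v"
  by (simp add: lsq_hess_def transpose_def vec_eq_iff mult.commute)

context
  fixes v :: "real ^ 'n \<Rightarrow> real"
  assumes v: "v \<in> borel_measurable M" and v2: "integrable M (\<lambda>z. (v z)\<^sup>2)"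
begin

lemmas integrable_v = integrable_times_continuous[OF v v2]

lemma trace_lsq_hess:
  "trace (lsq_hess v) = 2 * r\<^sup>2 * (LINT z|M. v z) / ((real CARD('n) + 2) * mixed_moment)"
proof -
  have int: "integrable M (\<lambda>z. v z * (z $ i * z $ i))" for i
    by (intro integrable_v continuous_intros)
  have "(\<Sum>i\<in>UNIV. (LINT z|M. v z * (z $ i * z $ i))) = (LINT z|M. (\<Sum>i\<in>UNIV. v z * (z $ i * z $ i)))"
    by (rule Bochner_Integration.integral_sum[OF int, symmetric])
  also have "\<dots> = (LINT z|M. r\<^sup>2 * v z)"
  proof (rule Bochner_Integration.integral_cong[OF refl])
    fix z assume "z \<in> space M"
    then have "(\<Sum>i\<in>UNIV. z $ i * z $ i) = r\<^sup>2" using inner_self by (simp add: inner_vec_def)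
    then show "(\<Sum>i\<in>UNIV. v z * (z $ i * z $ i)) = r\<^sup>2 * v z"
      by (simp add: mult.commute flip: sum_distrib_left)
  qed
  finally have "trace (lsq_hess v) = (r\<^sup>2 * (LINT z|M. v z)
      - real CARD('n) * (r\<^sup>2 * (LINT z|M. v z) / (real CARD('n) + 2))) / mixed_moment"
    by (simp add: trace_def lsq_hess_def sum_divide_distrib[symmetric] sum_subtractf)
  also have "\<dots> = 2 * r\<^sup>2 * (LINT z|M. v z) / ((real CARD('n) + 2) * mixed_moment)"
    using mixed_moment_pos by (simp add: divide_simps) (simp add: algebra_simps)
  finally show ?thesis .
qed

text \<open>
  Only the linear part of the fit is seen by an odd test function and only its quadratic part by an
  even one, as odd functions integrate to zero; so the normal equations decouple.
\<close>
lemma residual_orthogonal_linear: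
  "(LINT z|M. (v z - quad (lsq_grad v) (lsq_hess v) z) * z $ i) = 0"
proof -
  let ?G = "lsq_grad v" and ?H = "lsq_hess v"
  have 1: "(LINT z|M. (?G \<bullet> z) * z $ i) = (LINT z|M. v z * z $ i)"
    using second_moment[of ?G "axis i 1"] mixed_moment_pos radius_pos
    by (simp add: inner_axis inner_axis' lsq_grad_def)
  have 2: "(LINT z|M. z \<bullet> (?H *v z) * z $ i) = 0"
    by (rule integral_odd) (auto intro!: continuous_intros simp: matrix_vector_mult_minus_right)
  have "(LINT z|M. (v z - quad ?G ?H z) * z $ i)
      = (LINT z|M. v z * z $ i - (?G \<bullet> z) * z $ i - 1 / 2 * (z \<bullet> (?H *v z) * z $ i))"
    by (intro Bochner_Integration.integral_cong refl) (simp add: quad_def algebra_simps)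
  also have "\<dots> = (LINT z|M. v z * z $ i) - (LINT z|M. (?G \<bullet> z) * z $ i)
      - 1 / 2 * (LINT z|M. z \<bullet> (?H *v z) * z $ i)"
    by (subst Bochner_Integration.integral_diff Bochner_Integration.integral_mult_right_zero,
        (intro Bochner_Integration.integrable_diff integrable_v integrable_continuous continuous_intros)+)+ simp
  finally show ?thesis using 1 2 by simp
qed

lemma residual_orthogonal_quadratic:
  "(LINT z|M. (v z - quad (lsq_grad v) (lsq_hess v) z) * (z $ i * z $ j)) = 0"
proof -
  let ?G = "lsq_grad v" and ?H = "lsq_hess v"
  have 1: "(LINT z|M. z $ i * z $ j * (z \<bullet> (?H *v z))) = 2 * (LINT z|M. v z * (z $ i * z $ j))"
  proof -
    define V A where "V = (LINT z|M. v z * (z $ i * z $ j))"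
      and "A = r\<^sup>2 * (LINT z|M. v z) / (real CARD('n) + 2)"
    have "trace ?H = 2 * A / mixed_moment" by (simp add: trace_lsq_hess A_def)
    moreover have "?H $ i $ j = (V - (if i = j then A else 0)) / mixed_moment"
      by (simp add: lsq_hess_def V_def A_def)
    ultimately have "(LINT z|M. z $ i * z $ j * (z \<bullet> (?H *v z))) = 2 * V"
      using mixed_moment_pos unfolding fourth_moment_quadratic_form
      by (cases "i = j") (simp_all add: symmetric_matrix_nth[OF transpose_lsq_hess, of v j i] field_simps)
    then show ?thesis by (simp add: V_def)
  qed
  have 2: "(LINT z|M. (?G \<bullet> z) * (z $ i * z $ j)) = 0"
    by (rule integral_odd) (auto intro!: continuous_intros)
  have "(LINT z|M. (v z - quad ?G ?H z) * (z $ i * z $ j))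
      = (LINT z|M. v z * (z $ i * z $ j) - (?G \<bullet> z) * (z $ i * z $ j)
          - 1 / 2 * (z $ i * z $ j * (z \<bullet> (?H *v z))))"
    by (intro Bochner_Integration.integral_cong refl) (simp add: quad_def algebra_simps)
  also have "\<dots> = (LINT z|M. v z * (z $ i * z $ j)) - (LINT z|M. (?G \<bullet> z) * (z $ i * z $ j))
      - 1 / 2 * (LINT z|M. z $ i * z $ j * (z \<bullet> (?H *v z)))"
    by (subst Bochner_Integration.integral_diff Bochner_Integration.integral_mult_right_zero,
        (intro Bochner_Integration.integrable_diff integrable_v integrable_continuous continuous_intros)+)+ simp
  finally show ?thesis using 1 2 by simp
qed

text \<open>\<open>quad G K\<close> is a linear combination of coordinates and of products of two coordinates.\<close>
lemma residual_orthogonal: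
  "(LINT z|M. (v z - quad (lsq_grad v) (lsq_hess v) z) * quad G K z) = 0"
proof -
  let ?e = "\<lambda>z. v z - quad (lsq_grad v) (lsq_hess v) z"
  have int: "integrable M (\<lambda>z. ?e z * p z)" if "continuous_on UNIV p" for p
    unfolding left_diff_distrib using that
    by (intro Bochner_Integration.integrable_diff integrable_v integrable_continuous continuous_intros)
  have int1: "integrable M (\<lambda>z. ?e z * z $ i)"
    and int2: "integrable M (\<lambda>z. ?e z * (z $ i * z $ j))" for i j
    by (intro int continuous_intros)+
  have expand: "e * quad G K z = (\<Sum>i\<in>UNIV. G $ i * (e * z $ i))
      + (\<Sum>i\<in>UNIV. \<Sum>j\<in>UNIV. K $ i $ j / 2 * (e * (z $ i * z $ j)))" for e z
    unfolding quad_def inner_vec_def[of G] quadratic_form_eq_sum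
    by (simp add: distrib_left sum_distrib_left ac_simps)
  have "(LINT z|M. ?e z * quad G K z)
      = (LINT z|M. (\<Sum>i\<in>UNIV. G $ i * (?e z * z $ i))
          + (\<Sum>i\<in>UNIV. \<Sum>j\<in>UNIV. K $ i $ j / 2 * (?e z * (z $ i * z $ j))))"
    by (simp only: expand)
  also have "\<dots> = 0"
    by (simp add: int1 int2 residual_orthogonal_linear residual_orthogonal_quadratic
        del: Bochner_Integration.integral_diff)
  finally show ?thesis .
qed

lemma residual_pythagoras:
  "(LINT z|M. (v z - quad G H z)\<^sup>2) = (LINT z|M. (v z - quad (lsq_grad v) (lsq_hess v) z)\<^sup>2)
    + (LINT z|M. (quad (G - lsq_grad v) (H - lsq_hess v) z)\<^sup>2)"
proof -
  let ?e = "\<lambda>z. v z - quad (lsq_grad v) (lsq_hess v) z"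
  let ?d = "quad (G - lsq_grad v) (H - lsq_hess v)"
  have ed: "integrable M (\<lambda>z. ?e z * ?d z)"
    unfolding left_diff_distrib
    by (intro Bochner_Integration.integrable_diff integrable_v integrable_continuous continuous_intros)
  have e2: "integrable M (\<lambda>z. (?e z)\<^sup>2)"
  proof -
    have "integrable M (\<lambda>z. (v z)\<^sup>2 + (quad (lsq_grad v) (lsq_hess v) z)\<^sup>2
        - 2 * (v z * quad (lsq_grad v) (lsq_hess v) z))"
      by (intro Bochner_Integration.integrable_diff Bochner_Integration.integrable_add v2
          integrable_mult_right integrable_v integrable_continuous continuous_intros)
    then show ?thesis by (simp add: power2_diff mult.assoc)
  qed
  have d2: "integrable M (\<lambda>z. (?d z)\<^sup>2)" by (intro integrable_continuous continuous_intros)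
  have "(LINT z|M. (v z - quad G H z)\<^sup>2) = (LINT z|M. (?e z)\<^sup>2 - 2 * (?e z * ?d z) + (?d z)\<^sup>2)"
    by (intro Bochner_Integration.integral_cong refl)
       (simp add: quad_diff power2_eq_square algebra_simps)
  also have "\<dots> = (LINT z|M. (?e z)\<^sup>2) - 2 * (LINT z|M. ?e z * ?d z) + (LINT z|M. (?d z)\<^sup>2)"
    using e2 ed d2 by (simp del: right_diff_distrib_numeral)
  finally show ?thesis by (simp add: residual_orthogonal)
qed

end

text \<open>
  The explicit value shows that a quadratic polynomial \<open>quad G K\<close> with symmetric \<open>K\<close> which vanishes
  almost everywhere on the sphere is zero, and this makes the least squares problem strictly convex.
\<close>
lemma integral_quad_squared:
  assumes K: "transpose K = K"
  shows "(LINT z|M. (quad G K z)\<^sup>2) = mixed_moment * (real CARD('n) + 2) / r\<^sup>2 * (G \<bullet> G)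
    + mixed_moment / 4 * ((trace K)\<^sup>2 + 2 * (\<Sum>i\<in>UNIV. \<Sum>j\<in>UNIV. (K $ i $ j)\<^sup>2))"
proof -
  have cross: "(LINT z|M. (G \<bullet> z) * (z \<bullet> (K *v z))) = 0"
    by (rule integral_odd) (auto intro!: continuous_intros simp: matrix_vector_mult_minus_right)
  have int: "integrable M (\<lambda>z. z $ i * z $ j * (z \<bullet> (K *v z)))" for i j
    by (intro integrable_continuous continuous_intros)
  have "(LINT z|M. (z \<bullet> (K *v z)) * (z \<bullet> (K *v z)))
      = (LINT z|M. (\<Sum>i\<in>UNIV. \<Sum>j\<in>UNIV. K $ i $ j * (z $ i * z $ j * (z \<bullet> (K *v z)))))"
    by (subst (1) quadratic_form_eq_sum) (simp add: sum_distrib_left sum_distrib_right ac_simps)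
  also have "\<dots> = (\<Sum>i\<in>UNIV. \<Sum>j\<in>UNIV. K $ i $ j * (mixed_moment * ((if i = j then trace K else 0) + 2 * K $ i $ j)))"
    by (simp add: int fourth_moment_quadratic_form symmetric_matrix_nth[OF K] add.commute)
  also have "\<dots> = mixed_moment * ((trace K)\<^sup>2 + 2 * (\<Sum>i\<in>UNIV. \<Sum>j\<in>UNIV. (K $ i $ j)\<^sup>2))"
  proof -
    have "(\<Sum>i\<in>UNIV. \<Sum>j\<in>UNIV. K $ i $ j * (if i = j then trace K else 0)) = (trace K)\<^sup>2"
      by (simp add: if_distrib[of "\<lambda>x. _ * x"] trace_def power2_eq_square sum_distrib_right cong: if_cong)
    moreover have "K $ i $ j * (mixed_moment * ((if i = j then trace K else 0) + 2 * K $ i $ j))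
      = mixed_moment * (K $ i $ j * (if i = j then trace K else 0)) + mixed_moment * (2 * (K $ i $ j)\<^sup>2)" for i j
      by (simp add: power2_eq_square algebra_simps)
    ultimately show ?thesis
      by (simp only: sum.distrib sum_distrib_left[symmetric]) (simp add: distrib_left)
  qed
  finally have quartic: "(LINT z|M. (z \<bullet> (K *v z)) * (z \<bullet> (K *v z)))
    = mixed_moment * ((trace K)\<^sup>2 + 2 * (\<Sum>i\<in>UNIV. \<Sum>j\<in>UNIV. (K $ i $ j)\<^sup>2))" .
  have "(LINT z|M. (quad G K z)\<^sup>2) = (LINT z|M. (G \<bullet> z) * (G \<bullet> z) + (G \<bullet> z) * (z \<bullet> (K *v z))
      + 1 / 4 * ((z \<bullet> (K *v z)) * (z \<bullet> (K *v z))))"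
    by (intro Bochner_Integration.integral_cong refl) (simp add: quad_def power2_eq_square algebra_simps)
  also have "\<dots> = (LINT z|M. (G \<bullet> z) * (G \<bullet> z)) + (LINT z|M. (G \<bullet> z) * (z \<bullet> (K *v z)))
      + 1 / 4 * (LINT z|M. (z \<bullet> (K *v z)) * (z \<bullet> (K *v z)))"
    by (subst Bochner_Integration.integral_add Bochner_Integration.integral_mult_right_zero,
        (intro Bochner_Integration.integrable_add integrable_mult_right integrable_continuous continuous_intros)+)+ simp
  finally show ?thesis by (simp add: cross quartic second_moment)
qed

lemma integral_quad_squared_pos:
  assumes "transpose K = K" and "G \<noteq> 0 \<or> K \<noteq> 0"
  shows "(LINT z|M. (quad G K z)\<^sup>2) > 0"
proof -
  let ?T = "\<Sum>i\<in>UNIV. \<Sum>j\<in>UNIV. (K $ i $ j)\<^sup>2"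
  have T: "?T \<ge> 0" by (simp add: sum_nonneg)
  have "?T > 0" if "K \<noteq> 0"
  proof (rule ccontr)
    assume "\<not> ?T > 0"
    then have "?T = 0" using T by simp
    then have "K $ i $ j = 0" for i j by (simp add: sum_nonneg_eq_0_iff sum_nonneg)
    then show False using that by (simp add: vec_eq_iff)
  qed
  then have "K \<noteq> 0 \<Longrightarrow> mixed_moment / 4 * ((trace K)\<^sup>2 + 2 * ?T) > 0"
    using mixed_moment_pos by (intro mult_pos_pos add_nonneg_pos) auto
  moreover have "mixed_moment / 4 * ((trace K)\<^sup>2 + 2 * ?T) \<ge> 0"
    using T mixed_moment_pos by (intro mult_nonneg_nonneg) auto
  moreover have "mixed_moment * (real CARD('n) + 2) / r\<^sup>2 * (G \<bullet> G) \<ge> 0"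
    and "G \<noteq> 0 \<Longrightarrow> mixed_moment * (real CARD('n) + 2) / r\<^sup>2 * (G \<bullet> G) > 0"
    using mixed_moment_pos radius_pos by auto
  ultimately show ?thesis
    unfolding integral_quad_squared[OF assms(1)] using assms(2) by linarith
qed

lemma lsq_strict_minimum:
  assumes "v \<in> borel_measurable M" and "integrable M (\<lambda>z. (v z)\<^sup>2)"
    and "transpose H = H" and "(G, H) \<noteq> (lsq_grad v, lsq_hess v)"
  shows "(LINT z|M. (v z - quad (lsq_grad v) (lsq_hess v) z)\<^sup>2) < (LINT z|M. (v z - quad G H z)\<^sup>2)"
proof -
  have "transpose (H - lsq_hess v) = H - lsq_hess v"
    using assms(3) transpose_lsq_hess[of v] by (simp add: transpose_def vec_eq_iff)
  then have "(LINT z|M. (quad (G - lsq_grad v) (H - lsq_hess v) z)\<^sup>2) > 0"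
    using assms(4) by (intro integral_quad_squared_pos) auto
  then show ?thesis unfolding residual_pythagoras[OF assms(1,2), of G H] by simp
qed

text \<open>
  On the sphere \<open>norm z\<close> is the constant \<open>r\<close>, and the matrix in the integrand is even in \<open>z\<close>, so the
  terms with \<open>v z\<close> and with \<open>v (- z)\<close> contribute equally.
\<close>
lemma lsq_hess_eq_integral:
  assumes v: "v \<in> borel_measurable M" and v2: "integrable M (\<lambda>z. (v z)\<^sup>2)"
  shows "lsq_hess v = (r ^ 4 / (2 * mixed_moment)) *\<^sub>R (LINT z|M. ((v z + v (- z)) / (norm z)\<^sup>2) *\<^sub>R
    ((1 / (norm z)\<^sup>2) *\<^sub>R outer_prod z z - (1 / (real CARD('n) + 2)) *\<^sub>R mat 1))"
proof -
  let ?N = "real CARD('n)"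
  let ?F = "\<lambda>z :: real ^ 'n. ((v z + v (- z)) / (norm z)\<^sup>2) *\<^sub>R
    ((1 / (norm z)\<^sup>2) *\<^sub>R outer_prod z z - (1 / (?N + 2)) *\<^sub>R mat 1)"
  define f where "f i j z = (v z + v (- z)) * (z $ i * z $ j / r ^ 4 - (if i = j then 1 / (r\<^sup>2 * (?N + 2)) else 0))"
    for i j and z :: "real ^ 'n"
  have F: "?F z $ i $ j = f i j z" if "z \<in> space M" for z i j
  proof -
    have "norm z = r" using that by (simp add: space_eq)
    moreover have "s / r\<^sup>2 * (1 / r\<^sup>2 * t - 1 / (?N + 2) * d) = s * (t / r ^ 4 - d / (r\<^sup>2 * (?N + 2)))"
      for s t d
      by (simp add: right_diff_distrib power4_eq_xxxx power2_eq_square)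
    ultimately show ?thesis by (simp add: f_def outer_prod_def mat_def)
  qed
  have intp: "integrable M (\<lambda>z. v (- z) * p z)" and eqp: "(LINT z|M. v (- z) * p z) = (LINT z|M. v z * p z)"
    if p: "continuous_on UNIV p" and even: "\<And>z. p (- z) = p z" for p
  proof -
    note int = integrable_times_continuous[OF v v2 p]
    show "integrable M (\<lambda>z. v (- z) * p z)"
      using integrable_distr[OF orthogonal_measurable[OF orthogonal_uminus], of "\<lambda>z. v z * p z"] int
      by (simp add: distr_orthogonal[OF orthogonal_uminus] even)
    show "(LINT z|M. v (- z) * p z) = (LINT z|M. v z * p z)"
      using integral_reflect[OF borel_measurable_integrable[OF int]] by (simp add: even)
  qed
  have f_int: "integrable M (f i j)"
    and f_eq: "(LINT z|M. f i j z) = 2 * mixed_moment / r ^ 4 * lsq_hess v $ i $ j" for i j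
  proof -
    let ?p = "\<lambda>z :: real ^ 'n. z $ i * z $ j / r ^ 4 - (if i = j then 1 / (r\<^sup>2 * (?N + 2)) else 0)"
    have p: "continuous_on UNIV ?p" "\<And>z. ?p (- z) = ?p z"
      using radius_pos by (auto intro!: continuous_intros)
    note int = integrable_times_continuous[OF v v2 p(1)] intp[OF p]
    show "integrable M (f i j)"
      unfolding f_def distrib_right by (intro Bochner_Integration.integrable_add int)
    have "(LINT z|M. f i j z) = 2 * (LINT z|M. v z * ?p z)"
      unfolding f_def distrib_right Bochner_Integration.integral_add[OF int] eqp[OF p] by simp
    also have "(LINT z|M. v z * ?p z) = (LINT z|M. v z * (z $ i * z $ j) / r ^ 4
        - (if i = j then 1 / (r\<^sup>2 * (?N + 2)) else 0) * v z)"
      by (intro Bochner_Integration.integral_cong refl) (simp add: algebra_simps)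
    also have "\<dots> = (LINT z|M. v z * (z $ i * z $ j)) / r ^ 4
        - (if i = j then 1 / (r\<^sup>2 * (?N + 2)) else 0) * (LINT z|M. v z)"
    proof -
      have "integrable M v" using integrable_times_continuous[OF v v2, of "\<lambda>_. 1"] by simp
      moreover have "integrable M (\<lambda>z. v z * (z $ i * z $ j))"
        by (intro integrable_times_continuous[OF v v2] continuous_intros)
      ultimately show ?thesis by simp
    qed
    also have "\<dots> = mixed_moment / r ^ 4 * lsq_hess v $ i $ j"
      using mixed_moment_pos radius_pos by (simp add: lsq_hess_def divide_simps power4_eq_xxxx power2_eq_square)
    finally show "(LINT z|M. f i j z) = 2 * mixed_moment / r ^ 4 * lsq_hess v $ i $ j" by simp
  qed
  \<comment> \<open>The matrix integral is computed entrywise, which requires integrability of the matrix function.\<close>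
  have F_int: "integrable M ?F"
  proof -
    have "integrable M (\<lambda>z. \<Sum>i\<in>UNIV. \<Sum>j\<in>UNIV. f i j z *\<^sub>R axis i (axis j (1::real)))"
      by (intro Bochner_Integration.integrable_sum integrable_scaleR_left f_int)
    moreover have "?F z = (\<Sum>i\<in>UNIV. \<Sum>j\<in>UNIV. f i j z *\<^sub>R axis i (axis j (1::real)))" if "z \<in> space M" for z
    proof -
      have "(\<Sum>i\<in>UNIV. \<Sum>j\<in>UNIV. f i j z *\<^sub>R axis i (axis j (1::real))) $ k $ l = f k l z" for k l
      proof -
        have "(\<Sum>i\<in>UNIV. \<Sum>j\<in>UNIV. f i j z *\<^sub>R axis i (axis j (1::real))) $ k $ l
          = (\<Sum>i\<in>UNIV. \<Sum>j\<in>UNIV. if k = i then (if l = j then f i j z else 0) else 0)"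
          by (simp add: axis_def if_distrib[of "\<lambda>x. x $ l"] if_distrib[of "\<lambda>x. _ * x"] cong: if_cong)
        also have "\<dots> = (\<Sum>i\<in>UNIV. if k = i then f i l z else 0)"
          by (intro sum.cong refl) simp
        finally show ?thesis by simp
      qed
      then show ?thesis using F[OF that] by (simp only: vec_eq_iff simp_thms)
    qed
    ultimately show ?thesis
      by (subst Bochner_Integration.integrable_cong[OF refl,
            where g = "\<lambda>z. \<Sum>i\<in>UNIV. \<Sum>j\<in>UNIV. f i j z *\<^sub>R axis i (axis j (1::real))"])
  qed
  have "(LINT z|M. ?F z) $ i $ j = 2 * mixed_moment / r ^ 4 * lsq_hess v $ i $ j" for i j
  proof -
    have "(LINT z|M. ?F z $ i $ j) = (LINT z|M. ?F z) $ i $ j"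
      by (rule integral_bounded_linear[OF
            bounded_linear_compose[OF bounded_linear_vec_nth bounded_linear_vec_nth] F_int])
    moreover have "(LINT z|M. ?F z $ i $ j) = (LINT z|M. f i j z)"
      by (rule Bochner_Integration.integral_cong[OF refl F])
    ultimately show ?thesis by (simp only: f_eq)
  qed
  then show ?thesis
    using mixed_moment_pos radius_pos by (simp add: vec_eq_iff del: vector_minus_component)
qed

end

section \<open>Hausdorff measure on spheres is isotropic\<close>

text \<open>Orthogonal transformations are similarities of ratio \<open>1\<close> and preserve the sphere.\<close>
lemma isotropic_sphere_measure_hausdorff:
  fixes r :: real
  defines "S \<equiv> sphere (0 :: real ^ 'n) r"
  assumes r: "r > 0"
    and borel: "\<And>B. B \<in> sets borel \<Longrightarrow> B \<inter> S \<in> sets surface_measure"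
    and fin: "emeasure surface_measure S < \<infinity>"
  shows "isotropic_sphere_measure (restrict_space surface_measure S) r"
proof -
  let ?\<mu> = "surface_measure :: (real ^ 'n) measure" and ?M = "restrict_space surface_measure S"
  have S: "S \<in> sets ?\<mu>" using borel[of UNIV] by simp
  have sets_M: "A \<in> sets ?M \<longleftrightarrow> A \<subseteq> S \<and> A \<in> sets ?\<mu>" for A
    using S by (simp add: sets_restrict_space_iff)
  have space_M: "space ?M = S" by (simp add: space_restrict_space)
  have emeasure_M: "emeasure ?M A = hausdorff_outer (CARD('n) - 1) A" if "A \<in> sets ?M" for A
  proof -
    have "A \<subseteq> S" "A \<in> sets ?\<mu>" using that by (simp_all only: sets_M)
    then show ?thesis using S by (simp add: emeasure_restrict_space emeasure_hausdorff_measure)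
  qed
  have bij: "bij f" and dist: "dist (f x) (f y) = 1 * dist x y" and vimage: "A \<in> sets ?M \<Longrightarrow> f -` A \<in> sets ?M"
    if f: "orthogonal_transformation f" for f :: "real ^ 'n \<Rightarrow> real ^ 'n" and x y A
  proof -
    show bij: "bij f" using f by (rule orthogonal_transformation_bij)
    have d: "dist (f x) (f y) = 1 * dist x y" for x y
      using f by (simp add: orthogonal_transformation_isometry)
    then show "dist (f x) (f y) = 1 * dist x y" .
    assume A: "A \<in> sets ?M"
    then have A_sub: "A \<subseteq> S" and "A \<in> sets ?\<mu>" by (simp_all only: sets_M)
    then have "f -` A \<in> sets ?\<mu>"
      by (intro similarity_vimage_in_sets_hausdorff_measure[OF d _ bij])
         simp_all
    moreover have "f -` A \<subseteq> S"
      using A_sub f by (auto simp: S_def orthogonal_transformation_norm)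
    ultimately show "f -` A \<in> sets ?M" by (simp only: sets_M simp_thms)
  qed
  have meas: "f \<in> measurable ?M ?M" if f: "orthogonal_transformation f" for f :: "real ^ 'n \<Rightarrow> real ^ 'n"
  proof (rule measurableI)
    show "f x \<in> space ?M" if "x \<in> space ?M" for x
      using that f unfolding space_M by (simp add: S_def orthogonal_transformation_norm)
    show "f -` A \<inter> space ?M \<in> sets ?M" if "A \<in> sets ?M" for A
      using vimage[OF f that] by (rule sets.Int) simp
  qed
  show ?thesis
  proof (intro isotropic_sphere_measure.intro isotropic_sphere_measure_axioms.intro finite_measureI)
    show "emeasure ?M (space ?M) \<noteq> \<infinity>" using fin S unfolding space_M by (simp add: emeasure_restrict_space)
    show "space ?M = sphere 0 r" unfolding space_M by (simp only: S_def)
    show "r > 0" by (rule r)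
    show "(\<lambda>z. z) \<in> borel_measurable ?M"
      by (rule measurableI) (use borel in \<open>auto simp only: space_M sets_M vimage_ident UNIV_I space_borel\<close>)
    show "f \<in> measurable ?M ?M" if "orthogonal_transformation f" for f by (rule meas[OF that])
    show "distr ?M ?M f = ?M" if f: "orthogonal_transformation f" for f
    proof (rule measure_eqI)
      fix A assume "A \<in> sets (distr ?M ?M f)"
      then have A: "A \<in> sets ?M" by simp
      have "emeasure (distr ?M ?M f) A = emeasure ?M (f -` A)"
        unfolding emeasure_distr[OF meas[OF f] A]
          inf_absorb1[OF sets.sets_into_space[OF vimage[OF f A]]] ..
      also have "\<dots> = hausdorff_outer (CARD('n) - 1) (f ` (f -` A))"
        unfolding emeasure_M[OF vimage[OF f A]]
        using hausdorff_outer_similarity_image[OF dist[OF f] _ bij[OF f], of "CARD('n) - 1" "f -` A"]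
        by simp
      also have "f ` (f -` A) = A" using bij[OF f] by (simp add: bij_is_surj surj_image_vimage_eq)
      finally show "emeasure (distr ?M ?M f) A = emeasure ?M A" by (simp only: emeasure_M[OF A])
    qed simp
    show "measure ?M (space ?M) > 0"
    proof -
      have "S \<in> sets ?M" using S by (simp only: sets_M order_refl simp_thms)
      from emeasure_M[OF this] have "emeasure ?M (space ?M) = hausdorff_outer (CARD('n) - 1) S"
        unfolding space_M .
      then have "emeasure ?M (space ?M) > 0"
        using hausdorff_outer_sphere_pos[where 'n = 'n, OF r] by (simp only: S_def)
      moreover have "emeasure ?M (space ?M) < \<infinity>"
        using fin S unfolding space_M by (simp add: emeasure_restrict_space)
      ultimately show ?thesis by (simp add: measure_def enn2real_positive_iff)
    qed
  qed
qed

text \<open>Borel sets are carried over from the sphere of radius \<open>r\<close> to the unit sphere, on which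
  \<^const>\<open>C12\<close> is an integral, by the dilation \<open>z \<mapsto> r z\<close>.\<close>
lemma hausdorff_measure_sphere_scale:
  fixes r :: real
  defines "S \<equiv> sphere (0 :: real ^ 'n) r" and "U \<equiv> sphere (0 :: real ^ 'n) 1"
  assumes r: "r > 0"
    and borel: "\<And>B. B \<in> sets borel \<Longrightarrow> B \<inter> S \<in> sets surface_measure"
  shows "B \<in> sets borel \<Longrightarrow> B \<inter> U \<in> sets surface_measure"
    and "emeasure surface_measure S = ennreal (r ^ (CARD('n) - 1)) * emeasure surface_measure U"
proof -
  let ?f = "\<lambda>z :: real ^ 'n. r *\<^sub>R z"
  have dist: "dist (?f y) (?f z) = r * dist y z" for y z
    using r by (simp add: dist_norm scaleR_diff_right[symmetric])
  have bij: "bij ?f"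
    by (rule o_bij[where g = "\<lambda>z. (1 / r) *\<^sub>R z"]) (use r in \<open>auto simp: fun_eq_iff\<close>)
  have U: "B \<inter> U \<in> sets surface_measure" if B: "B \<in> sets borel" for B
  proof -
    have "(\<lambda>z. (1 / r) *\<^sub>R z) -` B \<in> sets (borel :: (real ^ 'n) measure)"
      using measurable_sets[OF _ B, of "\<lambda>z. (1 / r) *\<^sub>R z" borel] by simp
    then have "?f -` ((\<lambda>z. (1 / r) *\<^sub>R z) -` B \<inter> S) \<in> sets surface_measure"
      by (intro similarity_vimage_in_sets_hausdorff_measure[OF dist r bij] borel)
    also have "?f -` ((\<lambda>z. (1 / r) *\<^sub>R z) -` B \<inter> S) = B \<inter> U"
      using r by (auto simp: S_def U_def)
    finally show ?thesis .
  qed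
  show "B \<in> sets borel \<Longrightarrow> B \<inter> U \<in> sets surface_measure" by (rule U)
  have "S = ?f ` U"
  proof -
    have "z = ?f ((1 / r) *\<^sub>R z)" "(1 / r) *\<^sub>R z \<in> U" if "z \<in> S" for z
      using that r by (auto simp: S_def U_def)
    moreover have "?f ` U \<subseteq> S" using r by (auto simp: S_def U_def)
    ultimately show ?thesis by blast
  qed
  then show "emeasure surface_measure S = ennreal (r ^ (CARD('n) - 1)) * emeasure surface_measure U"
    using hausdorff_outer_similarity_image[OF dist r bij, of "CARD('n) - 1" U] borel[of UNIV] U[of UNIV]
    by (simp add: emeasure_hausdorff_measure)
qed

text \<open>For \<open>a \<noteq> b\<close> a single term of the tensor of fourth moments survives.  For \<open>N = 1\<close> the
  denominator \<open>N (N + 2)\<close> is the \<open>3\<close> of the convention for \<^const>\<open>C12\<close>.\<close>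
lemma C12_eq:
  fixes a b :: "'n::finite"
  assumes iso: "isotropic_sphere_measure (restrict_space surface_measure (sphere (0 :: real ^ 'n) 1)) 1"
    and S: "sphere (0 :: real ^ 'n) 1 \<in> sets surface_measure"
    and ab: "CARD('n) \<ge> 2 \<Longrightarrow> a \<noteq> b"
  shows "C12 a b = measure surface_measure (sphere (0 :: real ^ 'n) 1) / (real CARD('n) * (real CARD('n) + 2))"
proof (cases "CARD('n) = 1")
  case False
  let ?M = "restrict_space surface_measure (sphere (0 :: real ^ 'n) 1)"
  interpret isotropic_sphere_measure ?M 1 by (rule iso)
  have "CARD('n) > 0" by (rule zero_less_card_finite)
  then have "a \<noteq> b" using ab False by linarith
  have "C12 a b = (LINT z|?M. z $ a * z $ a * (z $ b * z $ b))"
    using False S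
    by (simp add: C12_def set_lebesgue_integral_def integral_restrict_space power2_eq_square)
  also have "\<dots> = mixed_moment" using \<open>a \<noteq> b\<close> unfolding fourth_moment_cart by simp
  finally show ?thesis
    unfolding mixed_moment_def using S by (simp add: measure_restrict_space space_restrict_space)
qed (simp add: C12_def)

section \<open>Measurability from integrability\<close>

lemma sq_residual_eq: "sq_residual u x G H z = (u (x + z) - u x - quad G H z)\<^sup>2"
  by (simp add: sq_residual_def quad_def algebra_simps)

lemma quad_add: "quad (G + G') (H + H') z = quad G H z + quad G' H' z"
  by (simp add: quad_def inner_add_left inner_add_right matrix_vector_mult_add_rdistrib algebra_simps)

text \<open>
  As \<open>(G, H)\<close> varies, polarisation recovers the integrability of every product of two polynomials
  \<open>quad G H z\<close>, and of such a polynomial with \<open>u (x + z) - u x\<close>.  On the sphere the polynomial with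
  \<open>G = 0\<close> and \<open>H = I\<close> is the constant \<open>h\<^sup>2 / 2\<close>.  Hence constants, the coordinates and
  \<open>u (x + z) - u x\<close> are integrable on the sphere, which contains the measurability of the sphere and of
  these functions, and the finiteness of the area.
\<close>
lemma sq_residual_integrable_imp:
  fixes u :: "real ^ 'n \<Rightarrow> real" and h :: real and x :: "real ^ 'n"
  defines "S \<equiv> sphere (0 :: real ^ 'n) h"
  assumes h: "h > 0"
    and int: "\<And>G H. set_integrable surface_measure S (sq_residual u x G H)"
  shows "emeasure surface_measure S < \<infinity>"
    and "B \<in> sets borel \<Longrightarrow> B \<inter> S \<in> sets surface_measure"
    and "set_integrable surface_measure S (\<lambda>z. u (x + z) - u x)"
    and "set_integrable surface_measure S (\<lambda>z. (u (x + z) - u x)\<^sup>2)"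
proof -
  let ?\<mu> = "surface_measure :: (real ^ 'n) measure"
  define v where "v z = u (x + z) - u x" for z
  define D where "D G H z = indicator S z *\<^sub>R (v z - quad G H z)\<^sup>2" for G H z
  have D: "integrable ?\<mu> (D G H)" for G H
    using int[of G H] by (simp add: D_def[abs_def] set_integrable_def sq_residual_eq v_def)
  have quad0: "quad 0 0 z = 0" for z :: "real ^ 'n" by (simp add: quad_def)
  have quad1: "quad 0 (mat 1) z = h\<^sup>2 / 2" if "z \<in> S" for z :: "real ^ 'n"
    using that by (simp add: quad_def S_def flip: power2_norm_eq_inner)
  have qq: "integrable ?\<mu> (\<lambda>z. indicator S z * (quad G H z * quad G' H' z))" for G H G' H'
  proof -
    have "integrable ?\<mu> (\<lambda>z. (D (G + G') (H + H') z - D G H z - D G' H' z + D 0 0 z) / 2)"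
      using D by simp
    also have "(\<lambda>z. (D (G + G') (H + H') z - D G H z - D G' H' z + D 0 0 z) / 2)
        = (\<lambda>z. indicator S z * (quad G H z * quad G' H' z))"
      by (simp add: D_def quad_add quad0 power2_eq_square fun_eq_iff algebra_simps)
    finally show ?thesis .
  qed
  have vq: "integrable ?\<mu> (\<lambda>z. indicator S z * (v z * quad G H z))" for G H
  proof -
    have "integrable ?\<mu> (\<lambda>z. (D 0 0 z - D G H z + indicator S z * (quad G H z * quad G H z)) / 2)"
      using D qq by simp
    also have "(\<lambda>z. (D 0 0 z - D G H z + indicator S z * (quad G H z * quad G H z)) / 2)
        = (\<lambda>z. indicator S z * (v z * quad G H z))"
      by (simp add: D_def quad0 power2_eq_square fun_eq_iff algebra_simps)
    finally show ?thesis .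
  qed
  \<comment> \<open>A factor \<open>quad 0 (mat 1)\<close> may be cancelled, being a nonzero constant on the sphere.\<close>
  have scale: "integrable ?\<mu> (\<lambda>z. indicator S z * f z)"
    if "integrable ?\<mu> (\<lambda>z. indicator S z * (f z * quad 0 (mat 1) z))" for f
  proof -
    have "integrable ?\<mu> (\<lambda>z. 2 / h\<^sup>2 * (indicator S z * (f z * quad 0 (mat 1) z)))"
      using that by simp
    also have "(\<lambda>z. 2 / h\<^sup>2 * (indicator S z * (f z * quad 0 (mat 1) z))) = (\<lambda>z. indicator S z * f z)"
    proof
      fix z
      show "2 / h\<^sup>2 * (indicator S z * (f z * quad 0 (mat 1) z)) = indicator S z * f z"
        using h by (cases "z \<in> S") (simp_all add: quad1)
    qed
    finally show ?thesis .
  qed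
  have "integrable ?\<mu> (\<lambda>z. indicator S z * quad 0 (mat 1) z)"
    by (rule scale[OF qq])
  then have "integrable ?\<mu> (\<lambda>z. indicator S z * (1 :: real))"
    by (intro scale[of "\<lambda>_. 1"]) simp
  then have "integrable ?\<mu> (indicator S :: _ \<Rightarrow> real)" by simp
  then have S: "S \<in> sets ?\<mu>" and fin: "emeasure ?\<mu> S < \<infinity>"
    by (auto simp: integrable_indicator_iff)
  show "emeasure ?\<mu> S < \<infinity>" by (rule fin)
  have coord: "integrable ?\<mu> (\<lambda>z. indicator S z * (z $ i))" for i
    using scale[OF qq[of "axis i 1" 0]] by (simp add: quad_def inner_axis')
  define F where "F z = indicator S z *\<^sub>R z" for z :: "real ^ 'n"
  have F: "F \<in> borel_measurable ?\<mu>"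
  proof (rule borel_measurable_euclidean_space[THEN iffD2], rule ballI)
    fix e :: "real ^ 'n" assume "e \<in> Basis"
    then obtain i where "e = axis i 1" by (auto simp: Basis_vec_def)
    then have "(\<lambda>z. F z \<bullet> e) = (\<lambda>z. indicator S z * z $ i)"
      by (simp add: F_def inner_axis fun_eq_iff)
    then show "(\<lambda>z. F z \<bullet> e) \<in> borel_measurable ?\<mu>"
      using borel_measurable_integrable[OF coord] by (simp only:)
  qed
  show "B \<inter> S \<in> sets ?\<mu>" if "B \<in> sets borel"
  proof -
    have "F -` B \<inter> space ?\<mu> \<inter> S \<in> sets ?\<mu>" using measurable_sets[OF F that] S by (rule sets.Int)
    also have "F -` B \<inter> space ?\<mu> \<inter> S = B \<inter> S" by (auto simp: F_def)
    finally show ?thesis .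
  qed
  show "set_integrable ?\<mu> S (\<lambda>z. u (x + z) - u x)"
    using scale[OF vq] by (simp add: set_integrable_def v_def)
  show "set_integrable ?\<mu> S (\<lambda>z. (u (x + z) - u x)\<^sup>2)"
    using D[of 0 0] by (simp add: set_integrable_def D_def[abs_def] v_def quad0)
qed

section \<open>The minimiser\<close>

theorem theorem4p2:
  fixes u :: "real ^ 'n \<Rightarrow> real" and h :: real and x :: "real ^ 'n" and a b :: 'n
  assumes "h > 0"
    and "CARD('n) \<ge> 2 \<Longrightarrow> a \<noteq> b"
    and "\<And>G H. set_integrable surface_measure (sphere 0 h) (sq_residual u x G H)"
  shows "(\<exists>!p. minimizing_pair u h x p) \<and>
    (\<forall>G' H'. minimizing_pair u h x (G', H') \<longrightarrow>
      H' = (1 / 2 * inverse (C12 a b) * inverse (h ^ (CARD('n) - 1))) *\<^sub>R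
        (LINT z:sphere 0 h|surface_measure.
          ((u (x + z) - 2 * u x + u (x - z)) / (norm z)\<^sup>2) *\<^sub>R
            ((1 / (norm z)\<^sup>2) *\<^sub>R outer_prod z z - (1 / (real CARD('n) + 2)) *\<^sub>R mat 1)))"
proof -
  let ?\<mu> = "surface_measure :: (real ^ 'n) measure"
  let ?S = "sphere (0 :: real ^ 'n) h" and ?U = "sphere (0 :: real ^ 'n) 1"
  let ?M = "restrict_space ?\<mu> ?S"
  let ?N = "real CARD('n)"
  define v where "v z = u (x + z) - u x" for z
  note imp = sq_residual_integrable_imp[OF assms(1,3)]
  have S: "?S \<in> sets ?\<mu>" using imp(2)[of UNIV] by simp
  have U: "?U \<in> sets ?\<mu>"
    using hausdorff_measure_sphere_scale(1)[OF assms(1) imp(2), of UNIV] by simp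
  have scale: "emeasure ?\<mu> ?S = ennreal (h ^ (CARD('n) - 1)) * emeasure ?\<mu> ?U"
    by (rule hausdorff_measure_sphere_scale(2)[OF assms(1) imp(2)])
  have U_fin: "emeasure ?\<mu> ?U < \<infinity>"
    using imp(1) assms(1) unfolding scale by (auto simp: ennreal_mult_less_top)
  interpret isotropic_sphere_measure ?M h
    by (rule isotropic_sphere_measure_hausdorff[OF assms(1) imp(2) imp(1)])
  have isoU: "isotropic_sphere_measure (restrict_space ?\<mu> ?U) 1"
    by (rule isotropic_sphere_measure_hausdorff[OF zero_less_one
          hausdorff_measure_sphere_scale(1)[OF assms(1) imp(2)] U_fin])
  have C12: "C12 a b = measure ?\<mu> ?U / (?N * (?N + 2))"
    by (rule C12_eq[OF isoU U]) (rule assms(2))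
  have mixed_moment: "mixed_moment = C12 a b * h ^ 4 * h ^ (CARD('n) - 1)"
  proof -
    have "measure ?\<mu> ?S = h ^ (CARD('n) - 1) * measure ?\<mu> ?U"
      using assms(1) unfolding measure_def scale by (simp add: enn2real_mult)
    then show ?thesis
      unfolding C12 mixed_moment_def using S
      by (simp add: measure_restrict_space space_restrict_space)
  qed
  have integral_M: "(LINT z|?M. f z) = (LINT z:?S|?\<mu>. f z)" for f :: "real ^ 'n \<Rightarrow> 'b::{banach, second_countable_topology}"
    using S by (simp add: set_lebesgue_integral_def integral_restrict_space)
  have v: "v \<in> borel_measurable ?M" and v2: "integrable ?M (\<lambda>z. (v z)\<^sup>2)"
    using imp(3,4) S by (auto simp: integrable_restrict_space set_integrable_def v_def[abs_def]
        intro!: borel_measurable_integrable)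
  have energy: "energy u h x (G, H) = 1 / 2 * (LINT z|?M. (v z - quad G H z)\<^sup>2)" for G H
    unfolding integral_M by (simp add: energy_def sq_residual_eq v_def)
  have less: "energy u h x (lsq_grad v, lsq_hess v) < energy u h x (G, H)"
    if "transpose H = H" "(G, H) \<noteq> (lsq_grad v, lsq_hess v)" for G H
    using lsq_strict_minimum[OF v v2 that] by (simp add: energy)
  have minimizing: "minimizing_pair u h x p \<longleftrightarrow> p = (lsq_grad v, lsq_hess v)" for p
  proof
    assume min: "minimizing_pair u h x p"
    obtain G H where p: "p = (G, H)" by (cases p)
    have sym: "transpose H = H" and not_less: "\<not> energy u h x (lsq_grad v, lsq_hess v) < energy u h x (G, H)"
      using min transpose_lsq_hess[of v] by (auto simp: minimizing_pair_def is_arg_min_def p)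
    show "p = (lsq_grad v, lsq_hess v)"
      using less[OF sym] not_less unfolding p by blast
  next
    assume p: "p = (lsq_grad v, lsq_hess v)"
    have "\<not> energy u h x (G, H) < energy u h x p" if "transpose H = H" for G H
      using less[OF that, of G] unfolding p by (cases "(G, H) = (lsq_grad v, lsq_hess v)") auto
    then show "minimizing_pair u h x p"
      using transpose_lsq_hess[of v] by (auto simp: minimizing_pair_def is_arg_min_def p)
  qed
  have "h ^ 4 / (2 * mixed_moment) = 1 / 2 * inverse (C12 a b) * inverse (h ^ (CARD('n) - 1))"
    unfolding mixed_moment using assms(1) by (simp add: inverse_eq_divide)
  moreover have "v z + v (- z) = u (x + z) - 2 * u x + u (x - z)" for z
    by (simp add: v_def)
  ultimately have hess: "lsq_hess v = (1 / 2 * inverse (C12 a b) * inverse (h ^ (CARD('n) - 1))) *\<^sub>R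
        (LINT z:?S|?\<mu>. ((u (x + z) - 2 * u x + u (x - z)) / (norm z)\<^sup>2) *\<^sub>R
            ((1 / (norm z)\<^sup>2) *\<^sub>R outer_prod z z - (1 / (?N + 2)) *\<^sub>R mat 1))"
    using lsq_hess_eq_integral[OF v v2] unfolding integral_M by (simp only:)
  show ?thesis
  proof (intro conjI allI impI)
    show "\<exists>!p. minimizing_pair u h x p"
      by (simp only: minimizing ex1_eq)
    fix G' H' assume "minimizing_pair u h x (G', H')"
    then have "H' = lsq_hess v" by (simp only: minimizing prod.inject)
    then show "H' = (1 / 2 * inverse (C12 a b) * inverse (h ^ (CARD('n) - 1))) *\<^sub>R
        (LINT z:?S|?\<mu>. ((u (x + z) - 2 * u x + u (x - z)) / (norm z)\<^sup>2) *\<^sub>R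
            ((1 / (norm z)\<^sup>2) *\<^sub>R outer_prod z z - (1 / (?N + 2)) *\<^sub>R mat 1))"
      by (simp only: hess)
  qed
qed

end
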